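(* Assume that the Compatibility Assumption (stated in the context) holds. Then, for every $S\in\mathcal Z^n$ and every $t>0$, $$\frac{d}{dt}\mathrm{KL}(\rho_t^S\,\|\,\pi)=\int v_t\,(P_S-P)(\Phi'\circ v_t)\,d\pi-\mathcal E_{\pi,P}(\Phi'\circ v_t,v_t),$$ where $\Phi(x)=x\log x$ (so $\Phi'=1+\log$) and $\mathcal E_{\pi,P}(f,g):=-\int g\,(P-I)f\,d\pi$ is the Dirichlet form associated with $(\pi,P)$.
   Context: $\mathcal P(\mathbb R^d)$ is the set of Borel probability measures on $\mathbb R^d$. For a Markov kernel $K$ on $\mathbb R^d$: $Kf(x)=\int f(y)\,K(x,dy)$ and $\mu K(A)=\int K(x,A)\,d\mu(x)$. $(\mathcal Z,\mathcal F)$ is a measurable space, $n\ge1$. For each $S\in\mathcal Z^n$, $(X^S_k)_{k\in\mathbb N}$ is a time-homogeneous Markov chain on $\mathbb R^d$ with Markov kernel $P_S$ and initial law $\mu_0\in\mathcal P(\mathbb R^d)$. $(N_t)_{t\ge0}$ is a Poisson process of intensity $1$ independent of all other random variables; $Y^S_t:=X^S_{N_t}$ and $\rho_t^S$ is the law of $Y_t^S$ (for fixed $S$). Prior: $P$ is a Markov kernel on $\mathbb R^d$ not depending on $S$, and $\pi\in\mathcal P(\mathbb R^d)$ is invariant under it ($\pi P=\pi$). It is assumed that $\mu_0\ll\pi$. Write $v_t:=\frac{d\rho_t^S}{d\pi}$. Dual operator: if $K$ is a Markov kernel such that $\mu\ll\pi\Rightarrow\mu K\ll\pi$, then $K^\star:L^1(\pi)\to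 L^1(\pi)$ is the linear operator defined on non-negative $f$ with $\int f\,d\pi=1$ by $K^\star f=\frac{d(\mu K)}{d\pi}$ with $d\mu=f\,d\pi$, and extended linearly. Compatibility Assumption: $\mathrm{KL}(\mu_0\|\pi)<+\infty$; $v_0=d\mu_0/d\pi$ is bounded away from $0$; for all $t\ge0$ the map $S\mapsto\mathrm{KL}(\rho_t^S\|\pi)$ is $\mathcal F^{\otimes n}$-measurable; and for all $S\in\mathcal Z^n$: (H.1) for all $\mu\in\mathcal P(\mathbb R^d)$, $\mu\ll\pi$ implies $\mu P_S\ll\pi$; (H.2) for all $t\ge0$, $\Phi(P_S^\star v_t)\in L^1(\pi)$, where $\Phi(x)=x\log x$, $\Phi(0)=0$. *)

theory Defs
  imports "HOL-Probability.Probability"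
begin

subsection \<open>Divergence and densities\<close>

text \<open>
  The library's \<^const>\<open>KL_divergence\<close> is a Bochner integral and hence \<open>0\<close> when the integral
  diverges; it also takes the reference measure as its first argument.  The negative part of
  \<open>ln (d\<mu>/d\<pi>)\<close> is always \<open>\<mu>\<close>-integrable, so a failure of integrability means that the
  divergence is infinite.
\<close>

definition KL :: "'a measure \<Rightarrow> 'a measure \<Rightarrow> ereal" where
  "KL \<mu> \<pi> =
    (if absolutely_continuous \<pi> \<mu> \<and> integrable \<mu> (entropy_density (exp 1) \<pi> \<mu>)
     then ereal (KL_divergence (exp 1) \<pi> \<mu>) else \<infinity>)"

definition dens :: "'a measure \<Rightarrow> 'a measure \<Rightarrow> 'a \<Rightarrow> real" where
  "dens \<pi> \<mu> x = enn2real (RN_deriv \<pi> \<mu> x)"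

text \<open>Since \<open>ln 0\<close> is a real number, \<open>Phi 0 = 0\<close>.\<close>

definition Phi :: "real \<Rightarrow> real" where
  "Phi x = x * ln x"

definition Phi' :: "real \<Rightarrow> real" where
  "Phi' x = 1 + ln x"

lemma DERIV_Phi: "x > 0 \<Longrightarrow> (Phi has_real_derivative Phi' x) (at x)"
  unfolding Phi_def[abs_def] Phi'_def
  by (auto intro!: derivative_eq_intros simp: field_simps)

subsection \<open>Markov kernels\<close>

text \<open>The measure \<open>\<mu> K\<close> is \<^const>\<open>Giry_Monad.bind\<close> \<open>\<mu> K\<close>.\<close>

abbreviation markov_kernel :: "('a::topological_space \<Rightarrow> 'a measure) \<Rightarrow> bool" where
  "markov_kernel K \<equiv> K \<in> borel \<rightarrow>\<^sub>M prob_algebra borel"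

definition kernel_op :: "('a \<Rightarrow> 'a measure) \<Rightarrow> ('a \<Rightarrow> real) \<Rightarrow> 'a \<Rightarrow> real" where
  "kernel_op K f x = (\<integral>y. f y \<partial>K x)"

text \<open>The dual operator: first on probability densities, then extended linearly by normalising the
  positive and the negative part of the argument (a part of mass \<open>0\<close> contributes \<open>0\<close>).\<close>

definition dual_density :: "'a measure \<Rightarrow> ('a \<Rightarrow> 'a measure) \<Rightarrow> ('a \<Rightarrow> real) \<Rightarrow> 'a \<Rightarrow> real" where
  "dual_density \<pi> K f = dens \<pi> (Giry_Monad.bind (density \<pi> (\<lambda>x. ennreal (f x))) K)"

definition dual_op :: "'a measure \<Rightarrow> ('a \<Rightarrow> 'a measure) \<Rightarrow> ('a \<Rightarrow> real) \<Rightarrow> 'a \<Rightarrow> real" where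
  "dual_op \<pi> K f x =
    (let a = (\<integral>y. max 0 (f y) \<partial>\<pi>); b = (\<integral>y. max 0 (- f y) \<partial>\<pi>)
     in a * dual_density \<pi> K (\<lambda>y. max 0 (f y) / a) x
      - b * dual_density \<pi> K (\<lambda>y. max 0 (- f y) / b) x)"

definition dirichlet_form ::
    "'a measure \<Rightarrow> ('a \<Rightarrow> 'a measure) \<Rightarrow> ('a \<Rightarrow> real) \<Rightarrow> ('a \<Rightarrow> real) \<Rightarrow> real" where
  "dirichlet_form \<pi> K f g = - (\<integral>x. g x * (kernel_op K f x - f x) \<partial>\<pi>)"

subsection \<open>Processes\<close>

text \<open>The events of \<open>M\<close> generated by the random variables \<open>X i\<close>, \<open>i \<in> I\<close>, with values in \<open>E\<close>.\<close>

definition gen_events :: "'w measure \<Rightarrow> 'e measure \<Rightarrow> 'i set \<Rightarrow> ('i \<Rightarrow> 'w \<Rightarrow> 'e) \<Rightarrow> 'w set set" where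
  "gen_events M E I X = sigma_sets (space M) {X i -` A \<inter> space M |i A. i \<in> I \<and> A \<in> sets E}"

definition markov_chain ::
    "'w measure \<Rightarrow> (nat \<Rightarrow> 'w \<Rightarrow> 'a::topological_space) \<Rightarrow> ('a \<Rightarrow> 'a measure) \<Rightarrow> 'a measure \<Rightarrow> bool" where
  "markov_chain M X K \<mu>\<^sub>0 \<longleftrightarrow>
    (\<forall>k. X k \<in> M \<rightarrow>\<^sub>M borel) \<and>
    distr M borel (X 0) = \<mu>\<^sub>0 \<and>
    (\<forall>k. \<forall>A\<in>sets borel. AE \<omega> in M.
      real_cond_exp M (sigma (space M) (gen_events M borel {..k} X))
        (\<lambda>\<omega>. indicator A (X (Suc k) \<omega>)) \<omega> = measure (K (X k \<omega>)) A)"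

text \<open>The path condition makes the truncated subtraction of natural numbers in the increments
  agree almost surely with the ordinary one.\<close>

definition poisson_process :: "'w measure \<Rightarrow> real \<Rightarrow> (real \<Rightarrow> 'w \<Rightarrow> nat) \<Rightarrow> bool" where
  "poisson_process M r N \<longleftrightarrow>
    (\<forall>t\<ge>0. N t \<in> M \<rightarrow>\<^sub>M count_space UNIV) \<and>
    (AE \<omega> in M. N 0 \<omega> = 0 \<and> mono_on {0..} (\<lambda>t. N t \<omega>) \<and>
      (\<forall>t\<ge>0. continuous (at_right t) (\<lambda>s. real (N s \<omega>)))) \<and>
    (\<forall>(m::nat) \<tau>. 0 \<le> \<tau> 0 \<and> mono \<tau> \<longrightarrow>
      prob_space.indep_vars M (\<lambda>_. count_space UNIV)
        (\<lambda>i \<omega>. N (\<tau> (Suc i)) \<omega> - N (\<tau> i) \<omega>) {..<m}) \<and>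
    (\<forall>s t. 0 \<le> s \<and> s < t \<longrightarrow>
      distr M (count_space UNIV) (\<lambda>\<omega>. N t \<omega> - N s \<omega>) = measure_pmf (poisson_pmf (r * (t - s))))"

end

theory Submission
  imports Defs
begin

text \<open>
  Let \<open>f\<^sub>k\<close> be the density of the law of \<open>X\<^sub>k\<close>. Conditioning on the Poisson clock gives
  \<open>v\<^sub>t = e\<^sup>-\<^sup>t \<Sum>\<^sub>k f\<^sub>k t\<^sup>k / k!\<close>, so \<open>\<partial>\<^sub>t v\<^sub>t = w\<^sub>t - v\<^sub>t\<close> pointwise, where \<open>w\<^sub>t = P\<^sub>S\<^sup>\<star> v\<^sub>t\<close> is the same series
  with shifted coefficients. Differentiating under the integral gives
  \<open>\<partial>\<^sub>t KL = \<integral> \<Phi>' (v\<^sub>t) (w\<^sub>t - v\<^sub>t) d\<pi>\<close>, and duality moves \<open>P\<^sub>S\<close> onto \<open>\<Phi>' (v\<^sub>t)\<close>; the prior \<open>P\<close> is added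
  and subtracted. All integrability rests on Young's inequality \<open>a ln b \<le> a ln a - a + b\<close>, on the
  lower bound \<open>v\<^sub>t \<ge> e\<^sup>-\<^sup>t c\<close>, and on \<open>v\<^sub>s \<le> e\<^sup>T v\<^sub>T\<close>, \<open>w\<^sub>s \<le> e\<^sup>T w\<^sub>T\<close> for \<open>s \<le> T\<close>, which make the
  hypotheses at the single time \<open>T\<close> dominate the derivative on \<open>(0, T)\<close>.
\<close>

section \<open>Elementary inequalities for \<open>x * ln x\<close>\<close>

text \<open>This is Young's inequality: multiply \<open>ln y \<le> y - 1\<close> at
  \<open>y = b / a\<close> by \<open>a\<close>. For \<open>a = 0\<close> only
  \<open>0 \<le> b\<close> remains.\<close>

lemma mult_ln_le:
  fixes a b :: real
  assumes "0 \<le> a" "0 < b"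
  shows "a * ln b \<le> a * ln a - a + b"
proof (cases "a = 0")
  case False
  with assms have a: "0 < a" by simp
  have "ln (b / a) \<le> b / a - 1"
    using a assms by (intro ln_le_minus_one) auto
  then have "a * ln (b / a) \<le> a * (b / a - 1)"
    using a by (intro mult_left_mono) auto
  then show ?thesis
    using a assms by (simp add: ln_div algebra_simps)
qed (use assms in simp)

lemma Phi_ge: "0 \<le> x \<Longrightarrow> -1 \<le> Phi x"
  using mult_ln_le[of x 1] by (simp add: Phi_def)

lemma borel_measurable_Phi [measurable]:
  shows "Phi \<in> borel_measurable borel" and "Phi' \<in> borel_measurable borel"
  unfolding Phi_def[abs_def] Phi'_def[abs_def] by measurable

text \<open>The absolute value exceeds \<open>ln x\<close> by twice the negative part of
  \<open>ln x\<close>, and that part is at most \<open>\<bar>ln d\<bar>\<close>.\<close>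

lemma abs_ln_le:
  fixes d x :: real
  assumes "0 < d" "d \<le> x"
  shows "\<bar>ln x\<bar> \<le> ln x + 2 * \<bar>ln d\<bar>"
proof -
  have "ln d \<le> ln x" using assms by (subst ln_le_cancel_iff) auto
  then show ?thesis by linarith
qed

text \<open>A lower bound on \<open>b\<close> turns the one-sided Young inequality into a two-sided
  one. Hence \<open>a * ln b\<close> is integrable as soon as \<open>Phi a\<close>, \<open>a\<close>
  and \<open>b\<close> are.\<close>

lemma mult_abs_ln_le:
  fixes a b d :: real
  assumes "0 \<le> a" "0 < d" "d \<le> b"
  shows "a * \<bar>ln b\<bar> \<le> Phi a + b + 2 * \<bar>ln d\<bar> * a"
proof -
  have "a * \<bar>ln b\<bar> \<le> a * (ln b + 2 * \<bar>ln d\<bar>)"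
    using assms abs_ln_le by (intro mult_left_mono) auto
  also have "\<dots> \<le> Phi a + b + 2 * \<bar>ln d\<bar> * a"
    using mult_ln_le[of a b] assms by (simp add: Phi_def algebra_simps)
  finally show ?thesis .
qed

text \<open>Carries integrability of \<open>Phi\<close> from the initial density \<open>a\<close>
  and the shifted mixture \<open>b\<close> to the mixture \<open>v\<close>. For
  \<open>v \<le> 1\<close> the value \<open>Phi v\<close> lies in \<open>[-1, 0]\<close>. Otherwise
  \<open>v\<close> is at most \<open>K * max a b\<close> with \<open>K = 1 + t\<close>, and
  \<open>Phi (K * m) = K * ln K * m + K * Phi m\<close>. Since \<open>Phi \<ge> -1\<close>, the
  summand \<open>2\<close> makes \<open>Phi a + Phi b + 2\<close> dominate the value of
  \<open>Phi\<close> at the maximum.\<close>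

lemma abs_Phi_le_of_le_add:
  assumes "0 \<le> a" "0 \<le> b" "0 \<le> v" "0 \<le> t" "v \<le> a + t * b"
  shows "\<bar>Phi v\<bar> \<le> 1 + (1 + t) * ln (1 + t) * (a + b) + (1 + t) * (Phi a + Phi b + 2)"
proof -
  define K where "K = 1 + t"
  have K: "K \<ge> 1" using assms by (simp add: K_def)
  have Kl: "0 \<le> ln K" using K by simp
  have nn: "0 \<le> Phi a + Phi b + 2" using Phi_ge[of a] Phi_ge[of b] assms by linarith
  have nn1: "0 \<le> K * ln K * (a + b)" using K Kl assms by simp
  have nn2: "0 \<le> K * (Phi a + Phi b + 2)" using K nn by simp
  have "Phi v \<le> K * ln K * (a + b) + K * (Phi a + Phi b + 2)"
  proof (cases "v \<le> 1")
    case True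
    then have "Phi v \<le> 0"
      using assms ln_le_zero_iff[of v] by (cases "v = 0") (auto simp: Phi_def mult_le_0_iff)
    then show ?thesis using nn1 nn2 by linarith
  next
    case False
    define m where "m = max a b"
    have "a + t * b \<le> m + t * m"
      using assms by (intro add_mono mult_left_mono) (auto simp: m_def)
    then have vm: "v \<le> K * m" using assms by (simp add: K_def algebra_simps)
    have "m \<noteq> 0" using vm False by auto
    then have m: "0 < m" using assms by (auto simp: m_def max_def)
    \<comment> \<open>Monotonicity of \<open>Phi\<close> holds here because both arguments exceed
      \<open>1\<close>, where \<open>ln\<close> is non-negative.\<close>
    have "Phi v \<le> (K * m) * ln (K * m)"
      unfolding Phi_def using vm False K m by (intro mult_mono) auto
    also have "\<dots> = K * ln K * m + K * Phi m"
      using K m by (simp add: Phi_def ln_mult algebra_simps)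
    also have "\<dots> \<le> K * ln K * (a + b) + K * (Phi a + Phi b + 2)"
    proof (intro add_mono mult_left_mono)
      show "Phi m \<le> Phi a + Phi b + 2"
        using Phi_ge[of a] Phi_ge[of b] assms by (auto simp: m_def max_def)
    qed (use K Kl assms in \<open>auto simp: m_def\<close>)
    finally show ?thesis .
  qed
  then show ?thesis
    using Phi_ge[OF \<open>0 \<le> v\<close>] nn1 nn2 unfolding K_def by linarith
qed

subsection \<open>Poisson mixtures\<close>

text \<open>The expectation of \<open>a\<close> at a Poisson variable of mean \<open>t\<close>. The
  exponential stands outside the sum so that the rest is a power series in \<open>t\<close>.\<close>

definition poisson_mix :: "(nat \<Rightarrow> real) \<Rightarrow> real \<Rightarrow> real" where
  "poisson_mix a t = exp (- t) * (\<Sum>k. a k / fact k * t ^ k)"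

text \<open>Infinite radius of convergence of the exponential generating function; negative
  \<open>t\<close> is included to match the theorem on differentiating power series.\<close>

definition exp_summable :: "(nat \<Rightarrow> real) \<Rightarrow> bool" where
  "exp_summable a \<longleftrightarrow> (\<forall>t. summable (\<lambda>k. a k / fact k * t ^ k))"

text \<open>Division by factorials turns formal differentiation into the shift of coefficients; on
  densities this shift is one application of the kernel.\<close>

lemma diffs_div_fact: "diffs (\<lambda>k. a k / fact k) = (\<lambda>k. a (Suc k) / fact k :: real)"
  by (auto simp: diffs_def fun_eq_iff field_simps fact_Suc simp del: of_nat_Suc)

lemma exp_summable_Suc:
  assumes "exp_summable a"
  shows "exp_summable (\<lambda>k. a (Suc k))"
  unfolding exp_summable_def
proof
  fix t
  have "summable (\<lambda>k. diffs (\<lambda>k. a k / fact k) k * t ^ k)"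
    using assms unfolding exp_summable_def by (intro termdiff_converges_all) auto
  then show "summable (\<lambda>k. a (Suc k) / fact k * t ^ k)"
    by (simp only: diffs_div_fact)
qed

text \<open>A power series that converges at \<open>m\<close> converges wherever
  \<open>\<bar>t\<bar> < m\<close>. Countably many times then decide all of them, so a single null
  set suffices later.\<close>

lemma exp_summable_of_nat:
  assumes "\<And>m::nat. summable (\<lambda>k. a k / fact k * real m ^ k)"
  shows "exp_summable a"
  unfolding exp_summable_def
proof
  fix t :: real
  obtain m :: nat where "\<bar>t\<bar> < real m" using reals_Archimedean2 by blast
  then show "summable (\<lambda>k. a k / fact k * t ^ k)"
    by (intro powser_inside[OF assms[of m]]) auto
qed

text \<open>The forward equation of the Poisson clock: the series contributes the shifted mixture,
  the factor \<open>exp (- t)\<close> contributes the mixture itself with a minus sign.\<close>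

lemma DERIV_poisson_mix:
  assumes "exp_summable a"
  shows "(poisson_mix a has_real_derivative poisson_mix (\<lambda>k. a (Suc k)) t - poisson_mix a t) (at t)"
proof -
  have "((\<lambda>t. \<Sum>k. a k / fact k * t ^ k) has_real_derivative
      (\<Sum>k. diffs (\<lambda>k. a k / fact k) k * t ^ k)) (at t)"
    using assms unfolding exp_summable_def by (intro termdiffs_strong_converges_everywhere) auto
  then have *: "((\<lambda>t. \<Sum>k. a k / fact k * t ^ k) has_real_derivative
      (\<Sum>k. a (Suc k) / fact k * t ^ k)) (at t)"
    by (simp only: diffs_div_fact)
  show ?thesis
    unfolding poisson_mix_def[abs_def]
    by (rule derivative_eq_intros * refl | simp)+
qed

context
  fixes a :: "nat \<Rightarrow> real"
  assumes nonneg: "\<And>k. 0 \<le> a k" and summable: "exp_summable a"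
begin

lemma poisson_mix_summable: "summable (\<lambda>k. a k / fact k * t ^ k)"
  using summable by (simp add: exp_summable_def)

lemma poisson_mix_sum_le:
  assumes "0 \<le> s" "s \<le> t"
  shows "(\<Sum>k. a k / fact k * s ^ k) \<le> (\<Sum>k. a k / fact k * t ^ k)"
  using assms nonneg by (intro suminf_le poisson_mix_summable mult_left_mono power_mono) auto

lemma poisson_mix_nonneg: "0 \<le> t \<Longrightarrow> 0 \<le> poisson_mix a t"
  unfolding poisson_mix_def using nonneg
  by (intro mult_nonneg_nonneg suminf_nonneg poisson_mix_summable) auto

text \<open>Keep only the term \<open>k = 0\<close>, the event that the clock has not yet
  rung.\<close>

lemma poisson_mix_ge:
  assumes "0 \<le> t"
  shows "exp (- t) * a 0 \<le> poisson_mix a t"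
proof -
  have "(\<Sum>k\<in>{0}. a k / fact k * t ^ k) \<le> (\<Sum>k. a k / fact k * t ^ k)"
    using assms nonneg by (intro sum_le_suminf poisson_mix_summable) auto
  then show ?thesis by (simp add: poisson_mix_def)
qed

text \<open>Without its exponential factor the series increases with time. Bounding
  \<open>exp (- s)\<close> by \<open>1\<close> and restoring \<open>exp (- t)\<close> costs the
  factor \<open>exp t\<close>.\<close>

lemma poisson_mix_le:
  assumes "0 \<le> s" "s \<le> t"
  shows "poisson_mix a s \<le> exp t * poisson_mix a t"
proof -
  have "exp (- s) * (\<Sum>k. a k / fact k * s ^ k) \<le> 1 * (\<Sum>k. a k / fact k * t ^ k)"
    using assms nonneg
    by (intro mult_mono poisson_mix_sum_le suminf_nonneg poisson_mix_summable) auto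
  also have "\<dots> = exp t * poisson_mix a t"
    by (simp add: poisson_mix_def exp_minus field_simps)
  finally show ?thesis by (simp add: poisson_mix_def)
qed

text \<open>Split off the term \<open>k = 0\<close> and bound \<open>1 / fact (Suc k)\<close> by
  \<open>1 / fact k\<close> in the others. This controls the mixture by its shift, the only one of
  the two whose entropy is controlled by hypothesis at positive times.\<close>

lemma poisson_mix_le_add:
  assumes "0 \<le> t"
  shows "poisson_mix a t \<le> a 0 + t * poisson_mix (\<lambda>k. a (Suc k)) t"
proof -
  have sm: "summable (\<lambda>k. a (Suc k) / fact k * t ^ k)"
    using exp_summable_Suc[OF summable] by (simp add: exp_summable_def)
  have "(\<Sum>k. a k / fact k * t ^ k) = a 0 + (\<Sum>k. a (Suc k) / fact (Suc k) * t ^ Suc k)"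
    using suminf_split_head[OF poisson_mix_summable[of t]] by simp
  also have "(\<Sum>k. a (Suc k) / fact (Suc k) * t ^ Suc k) \<le> (\<Sum>k. t * (a (Suc k) / fact k * t ^ k))"
  proof (intro suminf_le summable_mult sm)
    show "summable (\<lambda>k. a (Suc k) / fact (Suc k) * t ^ Suc k)"
      using poisson_mix_summable[of t] by (subst summable_Suc_iff)
    fix k
    have "a (Suc k) / fact (Suc k) \<le> a (Suc k) / fact k"
      using nonneg by (intro divide_left_mono fact_mono) auto
    then have "a (Suc k) / fact (Suc k) * t ^ Suc k \<le> a (Suc k) / fact k * t ^ Suc k"
      using assms by (intro mult_right_mono) auto
    then show "a (Suc k) / fact (Suc k) * t ^ Suc k \<le> t * (a (Suc k) / fact k * t ^ k)"
      by (simp add: mult_ac)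
  qed
  also have "\<dots> = t * (\<Sum>k. a (Suc k) / fact k * t ^ k)"
    by (rule suminf_mult[OF sm])
  finally have "exp (- t) * (\<Sum>k. a k / fact k * t ^ k) \<le>
      exp (- t) * (a 0 + t * (\<Sum>k. a (Suc k) / fact k * t ^ k))"
    by (intro mult_left_mono) auto
  also have "\<dots> = exp (- t) * a 0 + t * poisson_mix (\<lambda>k. a (Suc k)) t"
    by (simp add: poisson_mix_def algebra_simps)
  also have "exp (- t) * a 0 \<le> 1 * a 0"
    using assms nonneg by (intro mult_right_mono) auto
  finally show ?thesis by (simp add: poisson_mix_def)
qed

lemma ennreal_poisson_mix:
  assumes "0 < t"
  shows "ennreal (poisson_mix a t) = (\<Sum>k. ennreal (pmf (poisson_pmf t) k) * ennreal (a k))"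
proof -
  have "(\<lambda>k. exp (- t) * (a k / fact k * t ^ k)) sums poisson_mix a t"
    unfolding poisson_mix_def by (intro sums_mult summable_sums poisson_mix_summable)
  then have "(\<Sum>k. ennreal (exp (- t) * (a k / fact k * t ^ k))) = ennreal (poisson_mix a t)"
    using assms nonneg by (intro suminf_ennreal_eq) auto
  then show ?thesis
    using assms nonneg by (simp add: ennreal_mult'[symmetric] mult_ac)
qed

end

text \<open>The domination hypothesis concerns the derivative, not the difference quotients; the mean
  value theorem passes from one to the other.\<close>

lemma has_real_derivative_integral:
  fixes f f' :: "real \<Rightarrow> 'a \<Rightarrow> real"
  assumes t: "t \<in> {a<..<b}"
    and int: "\<And>s. s \<in> {a<..<b} \<Longrightarrow> integrable M (f s)"
    and meas: "f' t \<in> borel_measurable M"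
    and w: "integrable M w"
    and deriv: "AE x in M. \<forall>s\<in>{a<..<b}. ((\<lambda>s. f s x) has_real_derivative f' s x) (at s)"
    and bound: "AE x in M. \<forall>s\<in>{a<..<b}. \<bar>f' s x\<bar> \<le> w x"
  shows "((\<lambda>s. \<integral>x. f s x \<partial>M) has_real_derivative (\<integral>x. f' t x \<partial>M)) (at t)"
proof -
  \<comment> \<open>Dominated convergence is applied along sequences inside the interval, where the
    bound on \<open>f'\<close> holds; the interval is open, so the limit is the unrestricted
    one.\<close>
  have "((\<lambda>s. ((\<integral>x. f s x \<partial>M) - (\<integral>x. f t x \<partial>M)) / (s - t)) \<longlongrightarrow> (\<integral>x. f' t x \<partial>M))
      (at t within {a<..<b})"
    unfolding tendsto_at_iff_sequentially comp_def
  proof (intro allI impI)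
    fix X :: "nat \<Rightarrow> real"
    assume X: "\<forall>i. X i \<in> {a<..<b} - {t}" and lim: "X \<longlonglongrightarrow> t"
    have [measurable]: "f t \<in> borel_measurable M" "f (X i) \<in> borel_measurable M" for i
      using int t X by (auto intro: borel_measurable_integrable)
    have "(\<lambda>i. \<integral>x. (f (X i) x - f t x) / (X i - t) \<partial>M) \<longlonglongrightarrow> (\<integral>x. f' t x \<partial>M)"
    proof (rule integral_dominated_convergence[OF meas _ w])
      show "AE x in M. (\<lambda>i. (f (X i) x - f t x) / (X i - t)) \<longlonglongrightarrow> f' t x"
        using deriv
      proof eventually_elim
        case (elim x)
        then have "((\<lambda>s. (f s x - f t x) / (s - t)) \<longlongrightarrow> f' t x) (at t)"
          using t by (simp add: has_field_derivative_iff)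
        then show ?case
          using X lim unfolding tendsto_at_iff_sequentially comp_def by auto
      qed
      show "AE x in M. norm ((f (X i) x - f t x) / (X i - t)) \<le> w x" for i
        using deriv bound
      proof eventually_elim
        case (elim x)
        have Xi: "X i \<in> {a<..<b}" "X i \<noteq> t" using X by auto
        have "norm (f (X i) x - f t x) \<le> w x * norm (X i - t)"
        proof (rule field_differentiable_bound[where S="{a<..<b}" and f="\<lambda>s. f s x"])
          show "((\<lambda>s. f s x) has_field_derivative f' s x) (at s within {a<..<b})"
            if "s \<in> {a<..<b}" for s
            using elim(1) that by (auto intro: has_field_derivative_at_within)
        qed (use elim(2) Xi t in auto)
        then show ?case using Xi by (simp add: field_simps)
      qed
    qed measurable
    moreover have "(\<integral>x. (f (X i) x - f t x) / (X i - t) \<partial>M)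
        = ((\<integral>x. f (X i) x \<partial>M) - (\<integral>x. f t x \<partial>M)) / (X i - t)" for i
      using int[of "X i"] int[of t] t X by (simp add: Bochner_Integration.integral_diff)
    ultimately show "(\<lambda>i. ((\<integral>x. f (X i) x \<partial>M) - (\<integral>x. f t x \<partial>M)) / (X i - t))
        \<longlonglongrightarrow> (\<integral>x. f' t x \<partial>M)"
      by (simp only:)
  qed
  then have "((\<lambda>s. ((\<integral>x. f s x \<partial>M) - (\<integral>x. f t x \<partial>M)) / (s - t)) \<longlongrightarrow> (\<integral>x. f' t x \<partial>M)) (at t)"
    using t by (subst (asm) at_within_open) auto
  then show ?thesis by (simp add: has_field_derivative_iff)
qed

section \<open>Poisson mixtures of probability densities\<close>

lemma borel_measurable_poisson_mix [measurable]:
  assumes [measurable]: "\<And>k. f k \<in> borel_measurable M"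
  shows "(\<lambda>x. poisson_mix (\<lambda>k. f k x) t) \<in> borel_measurable M"
  unfolding poisson_mix_def by measurable

text \<open>By Tonelli, the series at time \<open>m\<close> has integral \<open>exp m\<close>, hence
  is finite almost everywhere; then let \<open>m\<close> run through the natural numbers.\<close>

lemma AE_exp_summable:
  fixes f :: "nat \<Rightarrow> 'a \<Rightarrow> real"
  assumes [measurable]: "\<And>k. f k \<in> borel_measurable M"
    and nonneg: "\<And>k x. 0 \<le> f k x"
    and mass: "\<And>k. (\<integral>\<^sup>+x. f k x \<partial>M) = 1"
  shows "AE x in M. exp_summable (\<lambda>k. f k x)"
proof -
  have "AE x in M. summable (\<lambda>k. f k x / fact k * real m ^ k)" for m :: nat
  proof -
    have "(\<integral>\<^sup>+x. (\<Sum>k. ennreal (f k x / fact k * real m ^ k)) \<partial>M)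
        = (\<Sum>k. \<integral>\<^sup>+x. ennreal (f k x / fact k * real m ^ k) \<partial>M)"
      by (rule nn_integral_suminf) measurable
    also have "\<dots> = (\<Sum>k. ennreal (real m ^ k / fact k))"
    proof (rule suminf_cong)
      fix k
      have "(\<integral>\<^sup>+x. ennreal (f k x / fact k * real m ^ k) \<partial>M)
          = (\<integral>\<^sup>+x. ennreal (real m ^ k / fact k) * ennreal (f k x) \<partial>M)"
        using nonneg by (intro nn_integral_cong) (simp add: ennreal_mult'[symmetric] mult_ac)
      then show "(\<integral>\<^sup>+x. ennreal (f k x / fact k * real m ^ k) \<partial>M) = ennreal (real m ^ k / fact k)"
        by (simp add: nn_integral_cmult mass)
    qed
    also have "\<dots> \<noteq> \<infinity>"
      using summable_exp_generic[of "real m"]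
      by (subst infinity_ennreal_def, intro ennreal_suminf_neq_top) (auto simp: divide_inverse mult_ac)
    finally have "AE x in M. (\<Sum>k. ennreal (f k x / fact k * real m ^ k)) \<noteq> \<infinity>"
      by (intro nn_integral_noteq_infinite) auto
    then show ?thesis
      by eventually_elim (auto intro!: summable_suminf_not_top simp: nonneg)
  qed
  then have "AE x in M. \<forall>m::nat. summable (\<lambda>k. f k x / fact k * real m ^ k)"
    by (simp add: AE_all_countable)
  then show ?thesis
    by eventually_elim (rule exp_summable_of_nat, auto)
qed

text \<open>Tonelli for the mixture. With \<open>h\<close> an indicator it yields the law at the
  Poisson time, and with \<open>h x = K x A\<close> the law after one more step of the
  kernel.\<close>

lemma nn_integral_poisson_mix:
  fixes f :: "nat \<Rightarrow> 'a \<Rightarrow> real"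
  assumes [measurable]: "\<And>k. f k \<in> borel_measurable M"
    and nonneg: "\<And>k x. 0 \<le> f k x"
    and mass: "\<And>k. (\<integral>\<^sup>+x. f k x \<partial>M) = 1"
    and [measurable]: "h \<in> borel_measurable M"
    and t: "0 < t"
  shows "(\<integral>\<^sup>+x. ennreal (poisson_mix (\<lambda>k. f k x) t) * h x \<partial>M)
    = (\<Sum>k. ennreal (pmf (poisson_pmf t) k) * (\<integral>\<^sup>+x. ennreal (f k x) * h x \<partial>M))"
proof -
  have "(\<integral>\<^sup>+x. ennreal (poisson_mix (\<lambda>k. f k x) t) * h x \<partial>M)
      = (\<integral>\<^sup>+x. (\<Sum>k. ennreal (pmf (poisson_pmf t) k) * (ennreal (f k x) * h x)) \<partial>M)"
    using AE_exp_summable[of f M, OF assms(1-3)]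
    by (intro nn_integral_cong_AE, eventually_elim)
       (simp add: ennreal_poisson_mix nonneg t flip: mult.assoc del: pmf_poisson)
  also have "\<dots> = (\<Sum>k. \<integral>\<^sup>+x. ennreal (pmf (poisson_pmf t) k) * (ennreal (f k x) * h x) \<partial>M)"
    by (rule nn_integral_suminf) measurable
  also have "\<dots> = (\<Sum>k. ennreal (pmf (poisson_pmf t) k) * (\<integral>\<^sup>+x. ennreal (f k x) * h x \<partial>M))"
    by (intro suminf_cong nn_integral_cmult) measurable
  finally show ?thesis .
qed

lemma suminf_pmf_nat: "(\<Sum>k. ennreal (pmf p (k::nat))) = 1"
  using measure_pmf.emeasure_space_1[of p]
  by (simp add: nn_integral_pmf[symmetric] nn_integral_count_space_nat)

lemma integrable_poisson_mix:
  fixes f :: "nat \<Rightarrow> 'a \<Rightarrow> real"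
  assumes [measurable]: "\<And>k. f k \<in> borel_measurable M"
    and nonneg: "\<And>k x. 0 \<le> f k x"
    and mass: "\<And>k. (\<integral>\<^sup>+x. f k x \<partial>M) = 1"
    and t: "0 < t"
  shows "integrable M (\<lambda>x. poisson_mix (\<lambda>k. f k x) t)"
proof (rule integrableI_nn_integral_finite)
  show "(\<integral>\<^sup>+x. ennreal (poisson_mix (\<lambda>k. f k x) t) \<partial>M) = ennreal 1"
    using nn_integral_poisson_mix[OF assms(1-3), of "\<lambda>_. 1" t] t
    by (simp add: mass suminf_pmf_nat del: pmf_poisson)
  show "AE x in M. 0 \<le> poisson_mix (\<lambda>k. f k x) t"
    using AE_exp_summable[of f M, OF assms(1-3)]
    by eventually_elim (use t in \<open>auto intro: poisson_mix_nonneg nonneg\<close>)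
qed measurable

lemma has_real_derivative_Phi_poisson_mix:
  assumes "exp_summable a" "0 < poisson_mix a t"
  shows "((\<lambda>s. Phi (poisson_mix a s)) has_real_derivative
    Phi' (poisson_mix a t) * (poisson_mix (\<lambda>k. a (Suc k)) t - poisson_mix a t)) (at t)"
  using DERIV_chain2[OF DERIV_Phi[OF assms(2)] DERIV_poisson_mix[OF assms(1)]] .

section \<open>Differentiation of the entropy of the mixture\<close>

text \<open>The analytic core, free of processes and kernels: \<open>f k\<close> is to be the
  density of the law of the chain at step \<open>k\<close>, and \<open>Phi_w\<close> is (H.2) at
  positive times once the shifted mixture is identified with the dual operator applied to the
  density.\<close>

locale poisson_density =
  fixes \<pi> :: "'a measure" and f :: "nat \<Rightarrow> 'a \<Rightarrow> real" and c :: real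
  assumes f_meas [measurable]: "\<And>k. f k \<in> borel_measurable \<pi>"
    and f_nonneg: "\<And>k x. 0 \<le> f k x"
    and f_mass: "\<And>k. (\<integral>\<^sup>+x. f k x \<partial>\<pi>) = 1"
    and c_pos: "0 < c"
    and f0_ge: "AE x in \<pi>. c \<le> f 0 x"
    and Phi_f0: "integrable \<pi> (\<lambda>x. Phi (f 0 x))"
    and Phi_w: "\<And>t. 0 < t \<Longrightarrow> integrable \<pi> (\<lambda>x. Phi (poisson_mix (\<lambda>k. f (Suc k) x) t))"
begin

abbreviation "v t x \<equiv> poisson_mix (\<lambda>k. f k x) t"
abbreviation "w t x \<equiv> poisson_mix (\<lambda>k. f (Suc k) x) t"

lemma AE_summable: "AE x in \<pi>. exp_summable (\<lambda>k. f k x)"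
  by (rule AE_exp_summable[OF f_meas f_nonneg f_mass])

lemma integrable_v: "0 < t \<Longrightarrow> integrable \<pi> (v t)"
  by (rule integrable_poisson_mix[OF f_meas f_nonneg f_mass])

lemma integrable_w: "0 < t \<Longrightarrow> integrable \<pi> (w t)"
  by (rule integrable_poisson_mix[where f="\<lambda>k. f (Suc k)", OF f_meas f_nonneg f_mass])

lemma integrable_f0: "integrable \<pi> (f 0)"
  using f_mass[of 0] by (intro integrableI_nn_integral_finite[where x=1]) (auto simp: f_nonneg)

text \<open>The exceptional null set does not depend on \<open>t\<close>, as differentiation in
  \<open>t\<close> at a fixed point requires.\<close>

lemma AE_v_ge:
  "AE x in \<pi>. \<forall>t\<ge>0. exp (- t) * c \<le> v t x"
  using AE_summable f0_ge
proof eventually_elim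
  case (elim x)
  have "exp (- t) * c \<le> exp (- t) * f 0 x" for t
    using elim by (intro mult_left_mono) auto
  then show ?case
    using poisson_mix_ge[OF f_nonneg elim(1)] order_trans by blast
qed

text \<open>The hypotheses control \<open>Phi\<close> of \<open>f 0\<close> and of
  \<open>w t\<close>; the bound \<open>v t x \<le> f 0 x + t * w t x\<close> passes this on to
  \<open>v t\<close>.\<close>

lemma integrable_Phi_v:
  assumes t: "0 < t"
  shows "integrable \<pi> (\<lambda>x. Phi (v t x))"
proof (rule Bochner_Integration.integrable_bound)
  show "integrable \<pi> (\<lambda>x. (1 + t) * ln (1 + t) * (f 0 x + w t x) + (1 + t) * (Phi (f 0 x) + Phi (w t x))
      + (1 + 2 * (1 + t)) / c * f 0 x)"
    using t by (intro Bochner_Integration.integrable_add integrable_mult_right integrable_f0 integrable_w Phi_f0 Phi_w)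
  show "AE x in \<pi>. norm (Phi (v t x)) \<le> norm ((1 + t) * ln (1 + t) * (f 0 x + w t x)
      + (1 + t) * (Phi (f 0 x) + Phi (w t x)) + (1 + 2 * (1 + t)) / c * f 0 x)"
    using AE_summable f0_ge
  proof eventually_elim
    case (elim x)
    note S = f_nonneg elim(1)
    have "\<bar>Phi (v t x)\<bar> \<le> 1 + (1 + t) * ln (1 + t) * (f 0 x + w t x)
        + (1 + t) * (Phi (f 0 x) + Phi (w t x) + 2)"
      using t poisson_mix_nonneg[OF S] poisson_mix_nonneg[OF f_nonneg exp_summable_Suc[OF elim(1)]]
        poisson_mix_le_add[OF S] f_nonneg
      by (intro abs_Phi_le_of_le_add) auto
    \<comment> \<open>Constants are absorbed into a multiple of \<open>f 0\<close>, which is at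
      least \<open>c\<close>, so the dominating function is built from integrable functions
      only.\<close>
    moreover have "1 + 2 * (1 + t) \<le> (1 + 2 * (1 + t)) / c * f 0 x"
      using mult_left_mono[OF elim(2), of "1 + 2 * (1 + t)"] c_pos t by (simp add: pos_le_divide_eq)
    ultimately show ?case by (simp add: algebra_simps)
  qed
qed measurable

text \<open>Young's inequality with the lower bound \<open>exp (- t) * c\<close> for
  \<open>v t\<close>; it serves for both \<open>u = v t\<close> and \<open>u = w t\<close>.\<close>

lemma integrable_mult_abs_ln:
  assumes [measurable]: "u \<in> borel_measurable \<pi>"
    and "AE x in \<pi>. 0 \<le> u x" "integrable \<pi> u" "integrable \<pi> (\<lambda>x. Phi (u x))" and t: "0 < t"
  shows "integrable \<pi> (\<lambda>x. u x * \<bar>ln (v t x)\<bar>)"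
proof (rule Bochner_Integration.integrable_bound)
  let ?d = "exp (- t) * c"
  show "integrable \<pi> (\<lambda>x. Phi (u x) + v t x + 2 * \<bar>ln ?d\<bar> * u x)"
    using assms by (intro Bochner_Integration.integrable_add integrable_mult_right integrable_v)
  show "AE x in \<pi>. norm (u x * \<bar>ln (v t x)\<bar>) \<le> norm (Phi (u x) + v t x + 2 * \<bar>ln ?d\<bar> * u x)"
    using AE_v_ge assms(2)
  proof eventually_elim
    case (elim x)
    then have "u x * \<bar>ln (v t x)\<bar> \<le> Phi (u x) + v t x + 2 * \<bar>ln ?d\<bar> * u x"
      using c_pos t by (intro mult_abs_ln_le) auto
    moreover have "0 \<le> u x * \<bar>ln (v t x)\<bar>" using elim by simp
    ultimately show ?case unfolding real_norm_def by linarith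
  qed
qed measurable

lemma AE_nonneg: "AE x in \<pi>. \<forall>t\<ge>0. 0 \<le> v t x \<and> 0 \<le> w t x"
  using AE_summable
  by eventually_elim (auto intro!: poisson_mix_nonneg f_nonneg exp_summable_Suc[where a="\<lambda>k. f k x" for x])

lemma integrable_v_abs_ln: "0 < t \<Longrightarrow> integrable \<pi> (\<lambda>x. v t x * \<bar>ln (v t x)\<bar>)"
  using AE_nonneg by (intro integrable_mult_abs_ln integrable_v integrable_Phi_v) auto

lemma integrable_w_abs_ln: "0 < t \<Longrightarrow> integrable \<pi> (\<lambda>x. w t x * \<bar>ln (v t x)\<bar>)"
  using AE_nonneg by (intro integrable_mult_abs_ln integrable_w Phi_w) auto

lemma has_real_derivative_entropy:
  assumes t: "0 < t"
  shows "((\<lambda>s. \<integral>x. Phi (v s x) \<partial>\<pi>) has_real_derivative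
    (\<integral>x. Phi' (v t x) * (w t x - v t x) \<partial>\<pi>)) (at t)"
proof (rule has_real_derivative_integral[where a=0 and b="t + 1"
      and f="\<lambda>s x. Phi (v s x)" and f'="\<lambda>s x. Phi' (v s x) * (w s x - v s x)"])
  \<comment> \<open>The right end of the interval: for every \<open>s\<close> in it,
    \<open>v s\<close> and \<open>w s\<close> are at most \<open>exp T\<close> times their values at
    \<open>T\<close>.\<close>
  define T where "T = t + 1"
  have T: "0 < T" using t by (simp add: T_def)
  let ?d = "exp (- T) * c"
  \<comment> \<open>The first factor bounds \<open>Phi' (v s x)\<close> through
    \<open>ln ?d \<le> ln (v s x) \<le> T + ln (v T x)\<close>, the second bounds
    \<open>w s x - v s x\<close>; neither depends on \<open>s\<close>.\<close>
  define B where "B = (\<lambda>x. (1 + \<bar>ln ?d\<bar> + T + \<bar>ln (v T x)\<bar>) * (exp T * (w T x + v T x)))"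
  have "integrable \<pi> (\<lambda>x. exp T * ((1 + \<bar>ln ?d\<bar> + T) * (w T x + v T x)
      + (w T x * \<bar>ln (v T x)\<bar> + v T x * \<bar>ln (v T x)\<bar>)))"
    using T by (intro Bochner_Integration.integrable_add integrable_mult_right integrable_v integrable_w
        integrable_v_abs_ln integrable_w_abs_ln)
  also have "(\<lambda>x. exp T * ((1 + \<bar>ln ?d\<bar> + T) * (w T x + v T x)
      + (w T x * \<bar>ln (v T x)\<bar> + v T x * \<bar>ln (v T x)\<bar>))) = B"
    unfolding B_def by (simp add: fun_eq_iff algebra_simps)
  finally show "integrable \<pi> B" .
  show "AE x in \<pi>. \<forall>s\<in>{0<..<t + 1}. \<bar>Phi' (v s x) * (w s x - v s x)\<bar> \<le> B x"
    using AE_summable AE_v_ge AE_nonneg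
  proof eventually_elim
    case (elim x)
    show ?case
    proof
      fix s assume "s \<in> {0<..<t + 1}"
      then have s: "0 < s" "s \<le> T" by (auto simp: T_def)
      have "?d \<le> exp (- s) * c" using s c_pos by (intro mult_right_mono) auto
      also have "\<dots> \<le> v s x" using elim(2) s by auto
      finally have lo: "?d \<le> v s x" .
      have d: "0 < ?d" using c_pos by simp
      have hi: "v s x \<le> exp T * v T x" "w s x \<le> exp T * w T x"
        using s by (auto intro!: poisson_mix_le f_nonneg elim(1) exp_summable_Suc[OF elim(1)])
      have vT: "0 < v T x" using elim(2)[rule_format, of T] T d by linarith
      have "ln ?d \<le> ln (v s x)" using lo d by (subst ln_le_cancel_iff) auto
      moreover have "ln (v s x) \<le> T + ln (v T x)"
      proof -
        have "ln (v s x) \<le> ln (exp T * v T x)" using lo d hi(1) by (subst ln_le_cancel_iff) auto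
        then show ?thesis using vT by (simp add: ln_mult)
      qed
      ultimately have "\<bar>Phi' (v s x)\<bar> \<le> 1 + \<bar>ln ?d\<bar> + T + \<bar>ln (v T x)\<bar>"
        unfolding Phi'_def using T by linarith
      moreover have "\<bar>w s x - v s x\<bar> \<le> exp T * (w T x + v T x)"
        using hi elim(3)[rule_format, of s] s unfolding distrib_left abs_le_iff by linarith
      ultimately show "\<bar>Phi' (v s x) * (w s x - v s x)\<bar> \<le> B x"
        unfolding B_def abs_mult by (intro mult_mono) auto
    qed
  qed
  show "AE x in \<pi>. \<forall>s\<in>{0<..<t + 1}. ((\<lambda>s. Phi (v s x)) has_real_derivative
      Phi' (v s x) * (w s x - v s x)) (at s)"
    using AE_summable AE_v_ge
  proof eventually_elim
    case (elim x)
    show ?case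
    proof
      fix s assume "s \<in> {0<..<t + 1}"
      then have "exp (- s) * c \<le> v s x" using elim(2) by auto
      moreover have "0 < exp (- s) * c" using c_pos by simp
      ultimately show "((\<lambda>s. Phi (v s x)) has_real_derivative Phi' (v s x) * (w s x - v s x)) (at s)"
        using has_real_derivative_Phi_poisson_mix[OF elim(1)] by force
    qed
  qed
qed (use t integrable_Phi_v in auto)

end

subsection \<open>Densities and kernels\<close>

text \<open>The derivative of a finite measure is finite almost everywhere, so the passage to real
  values in \<open>dens\<close> changes it only on a null set.\<close>

lemma (in prob_space) dens_properties:
  assumes "absolutely_continuous M N" "sets N = sets M" "prob_space N"
  shows dens_measurable [measurable]: "dens M N \<in> borel_measurable M"
    and dens_nonneg: "0 \<le> dens M N x"
    and density_dens: "density M (\<lambda>x. ennreal (dens M N x)) = N"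
    and nn_integral_dens: "(\<integral>\<^sup>+x. ennreal (dens M N x) \<partial>M) = 1"
proof -
  interpret N: prob_space N by fact
  show m [measurable]: "dens M N \<in> borel_measurable M" unfolding dens_def by measurable
  show "0 \<le> dens M N x" by (simp add: dens_def)
  have "AE x in M. RN_deriv M N x \<noteq> \<infinity>"
    by (rule RN_deriv_finite[OF _ assms(1,2)]) unfold_locales
  then have "AE x in M. ennreal (dens M N x) = RN_deriv M N x"
    by eventually_elim (auto simp: dens_def less_top)
  then have "density M (\<lambda>x. ennreal (dens M N x)) = density M (RN_deriv M N)"
    by (intro density_cong) auto
  also have "\<dots> = N" by (rule density_RN_deriv[OF assms(1,2)])
  finally show d: "density M (\<lambda>x. ennreal (dens M N x)) = N" .
  have "emeasure (density M (\<lambda>x. ennreal (dens M N x))) (space M) = 1"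
    unfolding d using N.emeasure_space_1 sets_eq_imp_space_eq[OF assms(2)] by simp
  then show "(\<integral>\<^sup>+x. ennreal (dens M N x) \<partial>M) = 1"
    by (simp add: emeasure_density)
qed

lemma (in prob_space) dens_unique:
  assumes [measurable]: "f \<in> borel_measurable M" and nonneg: "AE x in M. 0 \<le> f x"
    and "density M (\<lambda>x. ennreal (f x)) = N"
  shows "AE x in M. dens M N x = f x"
proof -
  have "AE x in M. ennreal (f x) = RN_deriv M N x"
    by (rule RN_deriv_unique[OF _ assms(3)]) measurable
  then show ?thesis
    using nonneg by eventually_elim (metis dens_def enn2real_ennreal)
qed

text \<open>Changing the measure from \<open>N\<close> to \<open>M\<close> multiplies the integrand
  \<open>ln (f x)\<close> by \<open>f x\<close>. This holds for integrability as well as for the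
  integral, so the infinite case is covered too.\<close>

lemma (in prob_space) KL_eq:
  assumes [measurable]: "f \<in> borel_measurable M" and nonneg: "AE x in M. 0 \<le> f x"
    and d: "density M (\<lambda>x. ennreal (f x)) = N"
  shows "KL N M = (if integrable M (\<lambda>x. Phi (f x)) then ereal (\<integral>x. Phi (f x) \<partial>M) else \<infinity>)"
proof -
  have ac: "absolutely_continuous M N"
    unfolding d[symmetric] by (rule absolutely_continuousI_density) measurable
  have eq: "AE x in M. entropy_density (exp 1) M N x = ln (f x)"
    using dens_unique[OF assms] by (auto simp: entropy_density_def dens_def log_def elim: eventually_mono)
  have "integrable N (entropy_density (exp 1) M N)
      \<longleftrightarrow> integrable M (\<lambda>x. f x * entropy_density (exp 1) M N x)"
    unfolding d[symmetric] by (rule integrable_real_density) (use nonneg in auto)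
  also have "\<dots> \<longleftrightarrow> integrable M (\<lambda>x. Phi (f x))"
    unfolding Phi_def using eq by (intro integrable_cong_AE) auto
  finally have 1: "integrable N (entropy_density (exp 1) M N) \<longleftrightarrow> integrable M (\<lambda>x. Phi (f x))" .
  have "KL_divergence (exp 1) M N = (\<integral>x. Phi (f x) \<partial>M)"
    unfolding d[symmetric] Phi_def using KL_density[of "exp 1" f] nonneg by (simp add: log_def)
  with 1 ac show ?thesis by (simp add: KL_def)
qed

text \<open>The positive part has mass \<open>1\<close>. The negative part has mass
  \<open>0\<close>, and its coefficient \<open>b = 0\<close> removes the term that divides by
  \<open>b\<close>.\<close>

lemma dual_op_eq_dual_density:
  assumes nonneg: "\<And>x. 0 \<le> f x" and "(\<integral>x. f x \<partial>M) = 1"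
  shows "dual_op M K f = dual_density M K f"
proof -
  have "max 0 (f x) = f x" "max 0 (- f x) = 0" for x
    using nonneg[of x] by auto
  then show ?thesis using assms by (simp add: dual_op_def fun_eq_iff Let_def)
qed

section \<open>Integrals against kernels\<close>

text \<open>Fubini for a kernel. The formula for non-negative functions is applied to the positive
  and negative parts of \<open>g\<close>; their kernel integrals \<open>p\<close> and
  \<open>n\<close> have finite integral, hence are finite almost everywhere.\<close>

lemma integral_bind_kernel:
  fixes g :: "'b \<Rightarrow> real"
  assumes K [measurable]: "K \<in> M \<rightarrow>\<^sub>M prob_algebra B" and ne: "space M \<noteq> {}"
    and int: "integrable (M \<bind> K) g"
  shows AE_integrable_kernel: "AE x in M. integrable (K x) g"
    and integrable_kernel_integral: "integrable M (\<lambda>x. \<integral>y. g y \<partial>K x)"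
    and integral_kernel_integral: "(\<integral>x. \<integral>y. g y \<partial>K x \<partial>M) = (\<integral>y. g y \<partial>(M \<bind> K))"
proof -
  have Ks: "K \<in> M \<rightarrow>\<^sub>M subprob_algebra B"
    using K by (rule measurable_prob_algebraD)
  have sb: "sets (M \<bind> K) = sets B"
    by (rule sets_bind[OF sets_kernel[OF Ks] ne])
  have g [measurable]: "g \<in> borel_measurable B"
    using borel_measurable_integrable[OF int] by (simp add: measurable_cong_sets[OF sb refl])
  have sK: "x \<in> space M \<Longrightarrow> sets (K x) = sets B" for x
    by (rule sets_kernel[OF Ks])
  have gK: "x \<in> space M \<Longrightarrow> g \<in> borel_measurable (K x)" for x
    using g by (simp add: measurable_cong_sets[OF sK refl])
  define p where "p x = (\<integral>\<^sup>+y. ennreal (g y) \<partial>K x)" for x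
  define n where "n x = (\<integral>\<^sup>+y. ennreal (- g y) \<partial>K x)" for x
  have g': "(\<lambda>y. ennreal (g y)) \<in> borel_measurable B" "(\<lambda>y. ennreal (- g y)) \<in> borel_measurable B"
    by measurable
  have [measurable]: "p \<in> borel_measurable M" "n \<in> borel_measurable M"
    unfolding p_def[abs_def] n_def[abs_def]
    by (rule measurable_compose[OF Ks nn_integral_measurable_subprob_algebra], rule g')+
  have fin: "(\<integral>\<^sup>+y. ennreal (g y) \<partial>(M \<bind> K)) \<noteq> \<infinity>" "(\<integral>\<^sup>+y. ennreal (- g y) \<partial>(M \<bind> K)) \<noteq> \<infinity>"
    using int by (auto simp: real_integrable_def)
  have ip: "(\<integral>\<^sup>+x. p x \<partial>M) = (\<integral>\<^sup>+y. ennreal (g y) \<partial>(M \<bind> K))"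
    unfolding p_def by (rule nn_integral_bind[symmetric, OF g'(1) Ks])
  have i_n: "(\<integral>\<^sup>+x. n x \<partial>M) = (\<integral>\<^sup>+y. ennreal (- g y) \<partial>(M \<bind> K))"
    unfolding n_def by (rule nn_integral_bind[symmetric, OF g'(2) Ks])
  have ae: "AE x in M. p x \<noteq> \<infinity>" "AE x in M. n x \<noteq> \<infinity>"
    by (rule nn_integral_noteq_infinite, measurable, use fin ip i_n in simp)+
  show A: "AE x in M. integrable (K x) g"
    using ae AE_space
    by eventually_elim (auto simp: real_integrable_def p_def n_def gK)
  have ep: "AE x in M. ennreal (enn2real (p x)) = p x" "AE x in M. ennreal (enn2real (n x)) = n x"
    using ae by (auto simp: less_top elim: eventually_mono)
  have ip': "(\<integral>\<^sup>+x. ennreal (enn2real (p x)) \<partial>M) = (\<integral>\<^sup>+y. ennreal (g y) \<partial>(M \<bind> K))"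
    unfolding ip[symmetric] by (rule nn_integral_cong_AE[OF ep(1)])
  have in': "(\<integral>\<^sup>+x. ennreal (enn2real (n x)) \<partial>M) = (\<integral>\<^sup>+y. ennreal (- g y) \<partial>(M \<bind> K))"
    unfolding i_n[symmetric] by (rule nn_integral_cong_AE[OF ep(2)])
  have I: "integrable M (\<lambda>x. enn2real (p x))" "integrable M (\<lambda>x. enn2real (n x))"
    using ip' in' fin by (auto intro!: integrableI_nonneg simp: less_top)
  have e: "AE x in M. (\<integral>y. g y \<partial>K x) = enn2real (p x) - enn2real (n x)"
    using A by eventually_elim (auto simp: real_lebesgue_integral_def p_def n_def)
  have mk [measurable]: "(\<lambda>x. \<integral>y. g y \<partial>K x) \<in> borel_measurable M"
    by (rule measurable_compose[OF Ks integral_measurable_subprob_algebra[OF g]])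
  have "integrable M (\<lambda>x. \<integral>y. g y \<partial>K x) \<longleftrightarrow> integrable M (\<lambda>x. enn2real (p x) - enn2real (n x))"
    by (rule integrable_cong_AE[OF _ _ e]) measurable
  then show "integrable M (\<lambda>x. \<integral>y. g y \<partial>K x)"
    using I by simp
  have "(\<integral>x. \<integral>y. g y \<partial>K x \<partial>M) = (\<integral>x. enn2real (p x) - enn2real (n x) \<partial>M)"
    by (rule integral_cong_AE[OF _ _ e]) measurable
  also have "\<dots> = (\<integral>x. enn2real (p x) \<partial>M) - (\<integral>x. enn2real (n x) \<partial>M)"
    using I by (rule Bochner_Integration.integral_diff)
  also have "\<dots> = (\<integral>y. g y \<partial>(M \<bind> K))"
    unfolding real_lebesgue_integral_def[OF int] by (simp add: integral_eq_nn_integral ip' in')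
  finally show "(\<integral>x. \<integral>y. g y \<partial>K x \<partial>M) = (\<integral>y. g y \<partial>(M \<bind> K))" .
qed

text \<open>Integrate Young's inequality \<open>v x * ln (v y) \<le> v x * ln (v x) - v x + v y\<close> over \<open>P x\<close>.\<close>

lemma integrable_mult_kernel_ln:
  fixes v :: "'a \<Rightarrow> real"
  assumes P [measurable]: "P \<in> \<pi> \<rightarrow>\<^sub>M prob_algebra \<pi>" and ne: "space \<pi> \<noteq> {}"
    and inv: "\<pi> \<bind> P = \<pi>"
    and v: "integrable \<pi> v" and Phi_v: "integrable \<pi> (\<lambda>x. Phi (v x))"
    and ln_v: "integrable \<pi> (\<lambda>x. ln (v x))"
    and d: "0 < d" "AE x in \<pi>. d \<le> v x"
  shows "integrable \<pi> (\<lambda>x. v x * (\<integral>y. ln (v y) \<partial>P x))"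
proof (rule Bochner_Integration.integrable_bound)
  have Ps: "P \<in> \<pi> \<rightarrow>\<^sub>M subprob_algebra \<pi>"
    using P by (rule measurable_prob_algebraD)
  have [measurable]: "v \<in> borel_measurable \<pi>" using v by auto
  note iv = integral_bind_kernel[OF P ne, unfolded inv, OF v]
  note iln = integral_bind_kernel[OF P ne, unfolded inv, OF ln_v]
  show "integrable \<pi> (\<lambda>x. \<bar>Phi (v x)\<bar> + \<bar>\<integral>y. v y \<partial>P x\<bar> + (1 + \<bar>ln d\<bar>) * v x)"
    by (intro Bochner_Integration.integrable_add integrable_mult_right integrable_abs v Phi_v iv)
  show "(\<lambda>x. v x * (\<integral>y. ln (v y) \<partial>P x)) \<in> borel_measurable \<pi>"
    using borel_measurable_integrable[OF iln(2)] by measurable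
  \<comment> \<open>Invariance carries the lower bound from \<pi> to \<open>P x\<close> for almost
    every \<open>x\<close>.\<close>
  have "AE x in \<pi> \<bind> P. d \<le> v x" unfolding inv by (rule d(2))
  then have "AE x in \<pi>. AE y in P x. d \<le> v y"
    by (subst (asm) AE_bind[OF Ps]) measurable
  then show "AE x in \<pi>. norm (v x * (\<integral>y. ln (v y) \<partial>P x))
      \<le> norm (\<bar>Phi (v x)\<bar> + \<bar>\<integral>y. v y \<partial>P x\<bar> + (1 + \<bar>ln d\<bar>) * v x)"
    using d(2) iv(1) iln(1) AE_space
  proof eventually_elim
    case (elim x)
    interpret Px: prob_space "P x"
      using measurable_space[OF P elim(5)] by (simp add: space_prob_algebra)
    have "v x * (\<integral>y. ln (v y) \<partial>P x) = (\<integral>y. v x * ln (v y) \<partial>P x)" by simp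
    also have "\<dots> \<le> (\<integral>y. (Phi (v x) - v x) + v y \<partial>P x)"
    proof (intro integral_mono_AE Bochner_Integration.integrable_add integrable_mult_right elim)
      show "AE y in P x. v x * ln (v y) \<le> (Phi (v x) - v x) + v y"
        using elim(1) by eventually_elim (use mult_ln_le[of "v x"] elim(2) d(1) in \<open>auto simp: Phi_def\<close>)
    qed simp
    also have "\<dots> = Phi (v x) - v x + (\<integral>y. v y \<partial>P x)"
      using elim(3) by (simp add: Px.prob_space)
    finally have up: "v x * (\<integral>y. ln (v y) \<partial>P x) \<le> Phi (v x) - v x + (\<integral>y. v y \<partial>P x)" .
    \<comment> \<open>Young's inequality bounds the product only from above; the bound from below
      comes from \<open>d \<le> v y\<close> under \<open>P x\<close>.\<close>
    have "ln d \<le> (\<integral>y. ln (v y) \<partial>P x)"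
    proof (rule Px.integral_ge_const[OF elim(4)])
      show "AE y in P x. ln d \<le> ln (v y)"
        using elim(1) by eventually_elim (use d(1) in auto)
    qed
    then have lo: "v x * ln d \<le> v x * (\<integral>y. ln (v y) \<partial>P x)"
      using elim(2) d(1) by (intro mult_left_mono) auto
    have "- (\<bar>ln d\<bar> * v x) \<le> v x * ln d" "0 \<le> \<bar>ln d\<bar> * v x"
      using elim(2) d(1) by (auto simp: abs_if algebra_simps)
    with up lo elim(2) d(1) show ?case
      unfolding real_norm_def distrib_right mult_1 by linarith
  qed
qed

subsection \<open>Markov chains at Poisson times\<close>

text \<open>Take expectations in the Markov property: the conditional expectation has the same
  integral as the indicator, so the past drops out.\<close>

lemma markov_chain_law_Suc:
  fixes K :: "'a::topological_space \<Rightarrow> 'a measure"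
  assumes "prob_space M" and chain: "markov_chain M X K \<mu>" and K: "markov_kernel K"
  shows "distr M borel (X (Suc k)) = distr M borel (X k) \<bind> K"
proof -
  interpret prob_space M by fact
  have X [measurable]: "X k \<in> M \<rightarrow>\<^sub>M borel" for k
    using chain by (simp add: markov_chain_def)
  have Ks: "K \<in> borel \<rightarrow>\<^sub>M subprob_algebra borel"
    using K by (rule measurable_prob_algebraD)
  let ?D = "distr M borel (X k)"
  have KD: "K \<in> ?D \<rightarrow>\<^sub>M subprob_algebra borel" using Ks by simp
  have ne: "space ?D \<noteq> {}" by simp
  show ?thesis
  proof (rule measure_eqI)
    show "sets (distr M borel (X (Suc k))) = sets (?D \<bind> K)"
      using sets_bind[OF sets_kernel[OF KD] ne] by simp
    fix A assume "A \<in> sets (distr M borel (X (Suc k)))"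
    then have A [measurable]: "A \<in> sets borel" by simp
    let ?F = "sigma (space M) (gen_events M borel {..k} X)"
    have "gen_events M borel {..k} X \<subseteq> sets M"
      unfolding gen_events_def by (rule sets.sigma_sets_subset) auto
    then have sub: "subalgebra M ?F"
      using sets.space_closed[of M]
      by (auto simp: subalgebra_def sets.sigma_sets_subset)
    interpret F: finite_measure_subalgebra M ?F
      by unfold_locales (rule sub)
    let ?I = "\<lambda>\<omega>. indicator A (X (Suc k) \<omega>) :: real"
    have I: "integrable M ?I"
      by (rule integrable_const_bound[where B=1]) (auto split: split_indicator)
    have meas: "(\<lambda>x. measure (K x) A) \<in> borel_measurable borel"
      using measurable_compose[OF Ks measurable_measure_subprob_algebra[OF A]] .
    have le1: "measure (K x) A \<le> 1" for x
      using measurable_space[OF K, of x] by (auto simp: space_prob_algebra intro: prob_space.prob_le_1)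
    have "(\<integral>\<omega>. ?I \<omega> \<partial>M) = (\<integral>\<omega>. real_cond_exp M ?F ?I \<omega> \<partial>M)"
      using F.real_cond_exp_int(2)[OF I] by simp
    also have "\<dots> = (\<integral>\<omega>. measure (K (X k \<omega>)) A \<partial>M)"
      using chain A meas by (intro integral_cong_AE) (auto simp: markov_chain_def)
    finally have eq: "(\<integral>\<omega>. ?I \<omega> \<partial>M) = (\<integral>\<omega>. measure (K (X k \<omega>)) A \<partial>M)" .
    have "emeasure (distr M borel (X (Suc k))) A = (\<integral>\<^sup>+x. indicator A x \<partial>distr M borel (X (Suc k)))"
      by simp
    also have "\<dots> = (\<integral>\<^sup>+\<omega>. ennreal (?I \<omega>) \<partial>M)"
      by (subst nn_integral_distr) (auto simp: ennreal_indicator)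
    also have "\<dots> = ennreal (\<integral>\<omega>. ?I \<omega> \<partial>M)"
      by (rule nn_integral_eq_integral[OF I]) simp
    also have "\<dots> = (\<integral>\<^sup>+\<omega>. ennreal (measure (K (X k \<omega>)) A) \<partial>M)"
      unfolding eq using meas le1
      by (intro nn_integral_eq_integral[symmetric] integrable_const_bound[where B=1]) auto
    also have "\<dots> = (\<integral>\<^sup>+\<omega>. emeasure (K (X k \<omega>)) A \<partial>M)"
    proof (rule nn_integral_cong)
      fix \<omega>
      interpret Kx: prob_space "K (X k \<omega>)"
        using measurable_space[OF K, of "X k \<omega>"] by (auto simp: space_prob_algebra)
      show "ennreal (measure (K (X k \<omega>)) A) = emeasure (K (X k \<omega>)) A"
        by (simp add: Kx.emeasure_eq_measure)
    qed
    also have "\<dots> = (\<integral>\<^sup>+x. emeasure (K x) A \<partial>?D)"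
      using measurable_compose[OF Ks measurable_emeasure_subprob_algebra[OF A]]
      by (simp add: nn_integral_distr)
    also have "\<dots> = emeasure (?D \<bind> K) A"
      by (rule emeasure_bind[symmetric, OF ne KD A])
    finally show "emeasure (distr M borel (X (Suc k))) A = emeasure (?D \<bind> K) A" .
  qed
qed

text \<open>Almost surely \<open>N 0\<close> vanishes, so \<open>N t\<close> is the increment over
  \<open>(0, t]\<close>.\<close>

lemma poisson_process_law:
  assumes "poisson_process M r N" "0 < t"
  shows "distr M (count_space UNIV) (N t) = measure_pmf (poisson_pmf (r * t))"
proof -
  have N [measurable]: "N s \<in> M \<rightarrow>\<^sub>M count_space UNIV" if "0 \<le> s" for s
    using assms that by (simp add: poisson_process_def)
  have [measurable]: "N t \<in> M \<rightarrow>\<^sub>M count_space UNIV" "N 0 \<in> M \<rightarrow>\<^sub>M count_space UNIV"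
    using assms N by auto
  have "AE \<omega> in M. N 0 \<omega> = 0"
    using assms by (auto simp: poisson_process_def elim: eventually_mono)
  then have "distr M (count_space UNIV) (N t) = distr M (count_space UNIV) (\<lambda>\<omega>. N t \<omega> - N 0 \<omega>)"
    by (intro distr_cong_AE) auto
  also have "\<dots> = measure_pmf (poisson_pmf (r * (t - 0)))"
    using assms unfolding poisson_process_def by blast
  finally show ?thesis by simp
qed

text \<open>Partition by the value of \<open>T\<close>: on \<open>T = k\<close> the sampled variable
  is \<open>X k\<close>, and independence factorises each piece.\<close>

lemma (in prob_space) emeasure_distr_random_index:
  fixes X :: "nat \<Rightarrow> 'a \<Rightarrow> 'b" and T :: "'a \<Rightarrow> nat"
  assumes X [measurable]: "\<And>k. X k \<in> M \<rightarrow>\<^sub>M E" and T [measurable]: "T \<in> M \<rightarrow>\<^sub>M count_space UNIV"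
    and law: "distr M (count_space UNIV) T = measure_pmf p"
    and indep: "\<And>k A. A \<in> sets E \<Longrightarrow>
      prob ((T -` {k} \<inter> space M) \<inter> (X k -` A \<inter> space M)) = prob (T -` {k} \<inter> space M) * prob (X k -` A \<inter> space M)"
    and A [measurable]: "A \<in> sets E"
  shows "emeasure (distr M E (\<lambda>\<omega>. X (T \<omega>) \<omega>)) A
    = (\<Sum>k. ennreal (pmf p k) * emeasure (distr M E (X k)) A)"
proof -
  have [measurable]: "(\<lambda>\<omega>. X (T \<omega>) \<omega>) \<in> M \<rightarrow>\<^sub>M E"
    by (rule measurable_compose_countable'[OF X T]) auto
  have "emeasure (distr M E (\<lambda>\<omega>. X (T \<omega>) \<omega>)) A = emeasure M ((\<lambda>\<omega>. X (T \<omega>) \<omega>) -` A \<inter> space M)"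
    by (rule emeasure_distr) measurable
  also have "(\<lambda>\<omega>. X (T \<omega>) \<omega>) -` A \<inter> space M
      = (\<Union>k. (T -` {k} \<inter> space M) \<inter> (X k -` A \<inter> space M))" by auto
  also have "emeasure M \<dots> = (\<Sum>k. emeasure M ((T -` {k} \<inter> space M) \<inter> (X k -` A \<inter> space M)))"
    by (intro suminf_emeasure[symmetric])
       (auto simp: disjoint_family_on_def intro!: sets.Int measurable_sets[OF X A] measurable_sets[OF T])
  also have "\<dots> = (\<Sum>k. ennreal (pmf p k) * emeasure (distr M E (X k)) A)"
  proof (rule suminf_cong)
    fix k
    have "pmf p k = measure (distr M (count_space UNIV) T) {k}"
      unfolding law by (simp add: pmf.rep_eq)
    also have "\<dots> = prob (T -` {k} \<inter> space M)"
      by (rule measure_distr) auto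
    finally have "pmf p k = prob (T -` {k} \<inter> space M)" .
    then show "emeasure M ((T -` {k} \<inter> space M) \<inter> (X k -` A \<inter> space M))
        = ennreal (pmf p k) * emeasure (distr M E (X k)) A"
      by (simp add: emeasure_distr emeasure_eq_measure indep ennreal_mult')
  qed
  finally show ?thesis .
qed

text \<open>Independence of the two generated families of events is used on their generators
  \<open>N t = k\<close> and \<open>X S k \<in> A\<close>.\<close>

lemma emeasure_distr_poisson_time:
  fixes X :: "'s \<Rightarrow> nat \<Rightarrow> 'w \<Rightarrow> 'a::topological_space"
  assumes "prob_space M"
    and X: "\<And>k. X S k \<in> M \<rightarrow>\<^sub>M borel" and S: "S \<in> Z"
    and poisson: "poisson_process M r N"
    and indep: "prob_space.indep_set M (gen_events M (count_space UNIV) {0..} N)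
      (gen_events M borel (Z \<times> UNIV) (\<lambda>(S, k). X S k))"
    and t: "0 < t" and A: "A \<in> sets borel"
  shows "emeasure (distr M borel (\<lambda>\<omega>. X S (N t \<omega>) \<omega>)) A
    = (\<Sum>k. ennreal (pmf (poisson_pmf (r * t)) k) * emeasure (distr M borel (X S k)) A)"
proof -
  interpret prob_space M by fact
  have N: "N t \<in> M \<rightarrow>\<^sub>M count_space UNIV"
    using poisson t by (simp add: poisson_process_def)
  show ?thesis
  proof (rule emeasure_distr_random_index[OF X N poisson_process_law[OF poisson t] _ A])
    fix k and A :: "'a set" assume A: "A \<in> sets borel"
    have "N t -` {k} \<inter> space M \<in> gen_events M (count_space UNIV) {0..} N"
      unfolding gen_events_def using t by (intro sigma_sets.Basic) force
    moreover have "X S k -` A \<inter> space M \<in> gen_events M borel (Z \<times> UNIV) (\<lambda>(S, k). X S k)"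
      unfolding gen_events_def using S A by (intro sigma_sets.Basic) force
    ultimately show "prob ((N t -` {k} \<inter> space M) \<inter> (X S k -` A \<inter> space M))
        = prob (N t -` {k} \<inter> space M) * prob (X S k -` A \<inter> space M)"
      by (rule indep_setD[OF indep])
  qed
qed

section \<open>The derivative of the divergence\<close>

text \<open>The processes enter only through the laws: \<open>\<mu> k\<close> evolves by the kernel
  \<open>K\<close>, and \<open>\<rho> t\<close> is the Poisson mixture of the
  \<open>\<mu> k\<close>.\<close>

lemma KL_poisson_mix_has_derivative:
  fixes \<pi> :: "'a::topological_space measure" and K P :: "'a \<Rightarrow> 'a measure"
    and \<mu> :: "nat \<Rightarrow> 'a measure" and \<rho> :: "real \<Rightarrow> 'a measure"
  defines "v \<equiv> \<lambda>t. dens \<pi> (\<rho> t)"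
  assumes pi: "\<pi> \<in> space (prob_algebra borel)"
    and K: "markov_kernel K" and P: "markov_kernel P" and inv: "\<pi> \<bind> P = \<pi>"
    and mu: "\<And>k. \<mu> k \<in> space (prob_algebra borel)" "\<And>k. absolutely_continuous \<pi> (\<mu> k)"
    and mu_Suc: "\<And>k. \<mu> (Suc k) = \<mu> k \<bind> K"
    and rho: "\<And>t. sets (\<rho> t) = sets borel"
      "\<And>t A. 0 < t \<Longrightarrow> A \<in> sets borel \<Longrightarrow>
        emeasure (\<rho> t) A = (\<Sum>k. ennreal (pmf (poisson_pmf t) k) * emeasure (\<mu> k) A)"
    and KL0: "KL (\<mu> 0) \<pi> < \<infinity>"
    and v0: "\<exists>c>0. AE x in \<pi>. c \<le> dens \<pi> (\<mu> 0) x"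
    and dual: "\<And>t. 0 < t \<Longrightarrow> integrable \<pi> (\<lambda>x. Phi (dual_op \<pi> K (v t) x))"
    and t: "0 < t"
  shows "KL (\<rho> t) \<pi> < \<infinity>" (is ?fin)
    and "AE x in \<pi>. integrable (K x) (Phi' \<circ> v t) \<and> integrable (P x) (Phi' \<circ> v t)" (is ?ae)
    and "integrable \<pi> (\<lambda>x. v t x * (kernel_op K (Phi' \<circ> v t) x - kernel_op P (Phi' \<circ> v t) x))" (is ?int1)
    and "integrable \<pi> (\<lambda>x. v t x * (kernel_op P (Phi' \<circ> v t) x - (Phi' \<circ> v t) x))" (is ?int2)
    and "((\<lambda>s. real_of_ereal (KL (\<rho> s) \<pi>)) has_real_derivative
      (\<integral>x. v t x * (kernel_op K (Phi' \<circ> v t) x - kernel_op P (Phi' \<circ> v t) x) \<partial>\<pi>)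
      - dirichlet_form \<pi> P (Phi' \<circ> v t) (v t)) (at t)" (is ?deriv)
proof -
  have sp [measurable_cong]: "sets \<pi> = sets borel" and pp: "prob_space \<pi>"
    using pi by (auto simp: space_prob_algebra)
  interpret prob_space \<pi> by (rule pp)
  have mu': "sets (\<mu> k) = sets \<pi>" "prob_space (\<mu> k)" for k
    using mu(1)[of k] by (auto simp: space_prob_algebra sp)
  have Ks: "K \<in> borel \<rightarrow>\<^sub>M subprob_algebra borel"
    using K by (rule measurable_prob_algebraD)
  have neU: "space N \<noteq> {}" if "sets N = sets (borel :: 'a measure)" for N :: "'a measure"
    using sets_eq_imp_space_eq[OF that] by simp
  define f where "f k = dens \<pi> (\<mu> k)" for k
  have fm [measurable]: "f k \<in> borel_measurable \<pi>" and fn: "0 \<le> f k x"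
    and fd: "density \<pi> (\<lambda>x. ennreal (f k x)) = \<mu> k" and f1: "(\<integral>\<^sup>+x. f k x \<partial>\<pi>) = 1" for k x
    unfolding f_def using dens_properties[OF mu(2) mu'] by auto
  \<comment> \<open>\<open>V\<close> is the version of the density given by the series, smooth in
    time at almost every point. The version \<open>v s\<close> agrees with it off a null set that
    may depend on \<open>s\<close>, so derivatives in time are taken of \<open>V\<close>.\<close>
  define V where "V s x = poisson_mix (\<lambda>k. f k x) s" for s x
  define W where "W s x = poisson_mix (\<lambda>k. f (Suc k) x) s" for s x
  have [measurable]: "V s \<in> borel_measurable \<pi>" "W s \<in> borel_measurable \<pi>" for s
    unfolding V_def[abs_def] W_def[abs_def] by measurable
  have nonneg: "AE x in \<pi>. 0 \<le> V s x \<and> 0 \<le> W s x" if "0 < s" for s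
    using AE_exp_summable[of f \<pi>, OF fm fn f1] unfolding V_def W_def
    by eventually_elim (use that in \<open>auto intro!: poisson_mix_nonneg fn exp_summable_Suc[where a="\<lambda>k. f k x" for x]\<close>)
  have V_density: "density \<pi> (\<lambda>x. ennreal (V s x)) = \<rho> s" if s: "0 < s" for s
  proof (rule measure_eqI)
    fix A assume "A \<in> sets (density \<pi> (\<lambda>x. ennreal (V s x)))"
    then have A [measurable]: "A \<in> sets \<pi>" by simp
    have "emeasure (density \<pi> (\<lambda>x. ennreal (V s x))) A = (\<integral>\<^sup>+x. ennreal (V s x) * indicator A x \<partial>\<pi>)"
      by (simp add: emeasure_density)
    also have "\<dots> = (\<Sum>k. ennreal (pmf (poisson_pmf s) k) * (\<integral>\<^sup>+x. ennreal (f k x) * indicator A x \<partial>\<pi>))"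
      unfolding V_def by (rule nn_integral_poisson_mix[OF fm fn f1 _ s]) measurable
    also have "(\<lambda>k. \<integral>\<^sup>+x. ennreal (f k x) * indicator A x \<partial>\<pi>) = (\<lambda>k. emeasure (\<mu> k) A)"
      unfolding fd[symmetric] by (simp add: emeasure_density)
    finally show "emeasure (density \<pi> (\<lambda>x. ennreal (V s x))) A = emeasure (\<rho> s) A"
      using A by (simp add: rho(2)[OF s] sp)
  qed (simp add: rho sp)
  have v_V: "AE x in \<pi>. v s x = V s x" if s: "0 < s" for s
    unfolding v_def using dens_unique[OF _ _ V_density[OF s]] nonneg[OF s] by auto
  \<comment> \<open>Shifting the index is one application of \<open>K\<close>: integrating
    \<open>f (Suc k)\<close> over \<open>A\<close> equals integrating \<open>f k x\<close> times
    \<open>emeasure (K x) A\<close>.\<close>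
  have W_density: "density \<pi> (\<lambda>x. ennreal (W s x)) = \<rho> s \<bind> K" if s: "0 < s" for s
  proof (rule measure_eqI)
    have Kr: "K \<in> \<rho> s \<rightarrow>\<^sub>M subprob_algebra borel"
      using Ks by (simp add: measurable_cong_sets[OF rho(1) refl])
    show "sets (density \<pi> (\<lambda>x. ennreal (W s x))) = sets (\<rho> s \<bind> K)"
      using sets_bind[OF sets_kernel[OF Kr] neU[OF rho(1)]] by (simp add: sp)
    fix A assume "A \<in> sets (density \<pi> (\<lambda>x. ennreal (W s x)))"
    then have A [measurable]: "A \<in> sets \<pi>" and A': "A \<in> sets borel" by (auto simp: sp)
    have h: "(\<lambda>x. emeasure (K x) A) \<in> borel_measurable borel"
      by (rule measurable_compose[OF Ks measurable_emeasure_subprob_algebra[OF A']])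
    have h' [measurable]: "(\<lambda>x. emeasure (K x) A) \<in> borel_measurable \<pi>"
      using h by (simp add: measurable_cong_sets[OF sp refl])
    have step: "(\<integral>\<^sup>+x. ennreal (f (Suc k) x) * indicator A x \<partial>\<pi>)
        = (\<integral>\<^sup>+x. ennreal (f k x) * emeasure (K x) A \<partial>\<pi>)" for k
    proof -
      have Km: "K \<in> \<mu> k \<rightarrow>\<^sub>M subprob_algebra borel"
        using Ks mu'(1)[of k] by (simp add: sp cong: measurable_cong_sets)
      have "(\<integral>\<^sup>+x. ennreal (f (Suc k) x) * indicator A x \<partial>\<pi>) = emeasure (\<mu> (Suc k)) A"
        unfolding fd[symmetric] by (simp add: emeasure_density)
      also have "\<dots> = (\<integral>\<^sup>+x. emeasure (K x) A \<partial>\<mu> k)"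
        unfolding mu_Suc using mu'(1)[of k] by (intro emeasure_bind[OF neU Km A']) (simp add: sp)
      also have "\<dots> = (\<integral>\<^sup>+x. ennreal (f k x) * emeasure (K x) A \<partial>\<pi>)"
        unfolding fd[symmetric] by (simp add: nn_integral_density)
      finally show ?thesis .
    qed
    have "emeasure (density \<pi> (\<lambda>x. ennreal (W s x))) A = (\<integral>\<^sup>+x. ennreal (W s x) * indicator A x \<partial>\<pi>)"
      by (simp add: emeasure_density)
    also have "\<dots> = (\<Sum>k. ennreal (pmf (poisson_pmf s) k) * (\<integral>\<^sup>+x. ennreal (f (Suc k) x) * indicator A x \<partial>\<pi>))"
      unfolding W_def by (rule nn_integral_poisson_mix[where f="\<lambda>k. f (Suc k)", OF fm fn f1 _ s]) measurable
    also have "\<dots> = (\<integral>\<^sup>+x. ennreal (V s x) * emeasure (K x) A \<partial>\<pi>)"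
      unfolding step V_def by (rule nn_integral_poisson_mix[OF fm fn f1 _ s, symmetric]) measurable
    also have "\<dots> = (\<integral>\<^sup>+x. emeasure (K x) A \<partial>\<rho> s)"
      unfolding V_density[OF s, symmetric] by (simp add: nn_integral_density)
    also have "\<dots> = emeasure (\<rho> s \<bind> K) A"
      by (rule emeasure_bind[symmetric, OF neU[OF rho(1)] Kr A'])
    finally show "emeasure (density \<pi> (\<lambda>x. ennreal (W s x))) A = emeasure (\<rho> s \<bind> K) A" .
  qed
  have rho_ps: "prob_space (\<rho> s)" if s: "0 < s" for s
  proof
    have "(\<integral>\<^sup>+x. ennreal (V s x) * 1 \<partial>\<pi>) = 1"
      unfolding V_def using f1 by (subst nn_integral_poisson_mix[OF fm fn f1 _ s])
        (auto simp: suminf_pmf_nat simp del: pmf_poisson)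
    then show "emeasure (\<rho> s) (space (\<rho> s)) = 1"
      unfolding V_density[OF s, symmetric] by (simp add: emeasure_density)
  qed
  have rho_ac: "absolutely_continuous \<pi> (\<rho> s)" if s: "0 < s" for s
    unfolding V_density[OF s, symmetric] by (rule absolutely_continuousI_density) measurable
  have vm [measurable]: "v s \<in> borel_measurable \<pi>" for s
    unfolding v_def dens_def[abs_def] by measurable
  have vn: "0 \<le> v s x" for s x
    unfolding v_def dens_def by simp
  have v_density: "density \<pi> (\<lambda>x. ennreal (v s x)) = \<rho> s" if "0 < s" for s
    unfolding v_def using that by (intro density_dens rho_ac rho_ps) (simp_all add: rho sp)
  \<comment> \<open>Since \<open>v s\<close> is a probability density, the dual operator yields the
    density of \<open>\<rho> s \<bind> K\<close>, which is \<open>W s\<close>. This turns (H.2) into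
    the hypothesis \<open>Phi_w\<close> of the locale.\<close>
  have dual_W: "AE x in \<pi>. dual_op \<pi> K (v s) x = W s x" if s: "0 < s" for s
  proof -
    have "(\<integral>\<^sup>+x. ennreal (v s x) \<partial>\<pi>) = ennreal 1"
      unfolding v_def ennreal_1 using s by (intro nn_integral_dens rho_ac rho_ps) (simp_all add: rho sp)
    then have "(\<integral>x. v s x \<partial>\<pi>) = 1"
      by (subst (asm) nn_integral_eq_integrable) (auto simp: vn)
    then have "dual_op \<pi> K (v s) = dens \<pi> (\<rho> s \<bind> K)"
      using vn by (subst dual_op_eq_dual_density) (auto simp: dual_density_def v_density[OF s])
    then show ?thesis
      using dens_unique[OF _ _ W_density[OF s]] nonneg[OF s] by auto
  qed
  obtain c where c: "0 < c" "AE x in \<pi>. c \<le> f 0 x"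
    using v0 unfolding f_def by blast
  interpret D: poisson_density \<pi> f c
  proof
    show "integrable \<pi> (\<lambda>x. Phi (f 0 x))"
      using KL0 KL_eq[OF fm _ fd, of 0] fn by (auto split: if_splits)
    show "integrable \<pi> (\<lambda>x. Phi (poisson_mix (\<lambda>k. f (Suc k) x) s))" if s: "0 < s" for s
    proof -
      have "AE x in \<pi>. Phi (dual_op \<pi> K (v s) x) = Phi (W s x)"
        using dual_W[OF s] by eventually_elim simp
      then have "integrable \<pi> (\<lambda>x. Phi (W s x))"
        using dual[OF s] borel_measurable_integrable[OF dual[OF s]]
        by (subst (asm) integrable_cong_AE) auto
      then show ?thesis by (simp add: W_def)
    qed
  qed (use fn f1 c in auto)
  have PhiV: "integrable \<pi> (\<lambda>x. Phi (V s x))" if "0 < s" for s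
    using D.integrable_Phi_v[OF that] by (simp add: V_def)
  have KL: "KL (\<rho> s) \<pi> = ereal (\<integral>x. Phi (V s x) \<partial>\<pi>)" if s: "0 < s" for s
    using KL_eq[OF _ _ V_density[OF s]] nonneg[OF s] PhiV[OF s] by auto
  show ?fin using KL[OF t] by simp

  let ?\<phi> = "Phi' \<circ> v t"
  define d where "d = exp (- t) * c"
  have d: "0 < d" using c by (simp add: d_def)
  have V_ge: "AE x in \<pi>. d \<le> V t x"
    using D.AE_v_ge by eventually_elim (use t in \<open>auto simp: V_def d_def\<close>)
  have v_ge: "AE x in \<pi>. d \<le> v t x"
    using V_ge v_V[OF t] by eventually_elim simp
  have iV: "integrable \<pi> (V t)" "integrable \<pi> (W t)"
    "integrable \<pi> (\<lambda>x. V t x * \<bar>ln (V t x)\<bar>)" "integrable \<pi> (\<lambda>x. W t x * \<bar>ln (V t x)\<bar>)"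
    using D.integrable_v[OF t] D.integrable_w[OF t] D.integrable_v_abs_ln[OF t] D.integrable_w_abs_ln[OF t]
    by (simp_all add: V_def[abs_def] W_def[abs_def])
  have iVln: "integrable \<pi> (\<lambda>x. V t x * ln (V t x))"
    by (rule Bochner_Integration.integrable_bound[OF iV(3)]) (auto simp: abs_mult)
  have iWln: "integrable \<pi> (\<lambda>x. W t x * ln (V t x))"
    by (rule Bochner_Integration.integrable_bound[OF iV(4)]) (auto simp: abs_mult)
  have iv: "integrable \<pi> (v t)"
    using iV(1) v_V[OF t] by (subst integrable_cong_AE) auto
  have iPhiv: "integrable \<pi> (\<lambda>x. Phi (v t x))"
  proof -
    have "AE x in \<pi>. Phi (v t x) = Phi (V t x)" using v_V[OF t] by eventually_elim simp
    then show ?thesis using PhiV[OF t] by (subst integrable_cong_AE) auto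
  qed
  have ivln: "integrable \<pi> (\<lambda>x. v t x * ln (v t x))"
    using iPhiv by (simp add: Phi_def)
  \<comment> \<open>From \<open>d \<le> v t x\<close> follows \<open>\<bar>ln (v t x)\<bar> \<le> v
    t x * \<bar>ln (v t x)\<bar> / d\<close>.\<close>
  have iln: "integrable \<pi> (\<lambda>x. ln (v t x))"
  proof (rule Bochner_Integration.integrable_bound)
    show "integrable \<pi> (\<lambda>x. v t x * ln (v t x) / d)" using ivln by (rule integrable_divide)
    show "AE x in \<pi>. norm (ln (v t x)) \<le> norm (v t x * ln (v t x) / d)"
      using v_ge
    proof eventually_elim
      case (elim x)
      have "d * \<bar>ln (v t x)\<bar> \<le> v t x * \<bar>ln (v t x)\<bar>"
        using elim by (intro mult_right_mono) auto
      then show ?case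
        using d elim vn[of t x] unfolding real_norm_def abs_divide abs_mult
        by (simp add: pos_le_divide_eq mult.commute)
    qed
  qed measurable
  have i\<phi>: "integrable \<pi> ?\<phi>" "integrable \<pi> (\<lambda>x. v t x * ?\<phi> x)"
    using iln iv ivln by (simp_all add: Phi'_def comp_def distrib_left)
  have Vv: "AE x in \<pi>. W t x * ?\<phi> x = W t x + W t x * ln (V t x)"
    using v_V[OF t] by eventually_elim (simp add: Phi'_def distrib_left)
  have iW\<phi>: "integrable \<pi> (\<lambda>x. W t x * ?\<phi> x)"
    using iV(2) iWln by (subst integrable_cong_AE[OF _ _ Vv]) auto
  have KB: "integrable (\<rho> t \<bind> K) ?\<phi>" "(\<integral>x. ?\<phi> x \<partial>(\<rho> t \<bind> K)) = (\<integral>x. W t x * ?\<phi> x \<partial>\<pi>)"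
    unfolding W_density[OF t, symmetric]
    using iW\<phi> nonneg[OF t] by (auto simp: integrable_real_density integral_real_density)
  have Kr: "K \<in> \<rho> t \<rightarrow>\<^sub>M prob_algebra borel"
    using K by (simp add: measurable_cong_sets[OF rho(1) refl])
  note Kint = integral_bind_kernel[OF Kr neU[OF rho(1)] KB(1)]
  \<comment> \<open>Fubini gives this almost everywhere for \<open>\<rho> t\<close>. The density
    \<open>v t\<close> is at least \<open>d > 0\<close>, so null sets of \<open>\<rho> t\<close> are
    null sets of \<pi>.\<close>
  have AEK: "AE x in \<pi>. integrable (K x) ?\<phi>"
  proof -
    have "AE x in \<pi>. 0 < ennreal (v t x) \<longrightarrow> integrable (K x) ?\<phi>"
      using Kint(1) unfolding v_density[OF t, symmetric] by (subst (asm) AE_density) auto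
    then show ?thesis
      using v_ge by eventually_elim (use d in auto)
  qed
  have kK [measurable]: "kernel_op K ?\<phi> \<in> borel_measurable \<pi>"
    using borel_measurable_integrable[OF Kint(2)]
    by (simp add: kernel_op_def[abs_def] comp_def measurable_cong_sets[OF rho(1) refl] measurable_cong_sets[OF sp refl])
  have ivK: "integrable \<pi> (\<lambda>x. v t x * kernel_op K ?\<phi> x)"
    using Kint(2) unfolding v_density[OF t, symmetric] kernel_op_def[symmetric]
    by (subst (asm) integrable_real_density) (auto simp: vn)
  \<comment> \<open>The duality between \<open>K\<close> and its dual operator, with both sides
    equal to the integral of \<open>?\<phi>\<close> against
    \<open>\<rho> t \<bind> K\<close>.\<close>
  have intK: "(\<integral>x. v t x * kernel_op K ?\<phi> x \<partial>\<pi>) = (\<integral>x. W t x * ?\<phi> x \<partial>\<pi>)"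
  proof -
    have "(\<integral>x. v t x * kernel_op K ?\<phi> x \<partial>\<pi>) = (\<integral>x. kernel_op K ?\<phi> x \<partial>\<rho> t)"
      unfolding v_density[OF t, symmetric] by (subst integral_real_density) (auto simp: vn)
    then show ?thesis using Kint(3) KB(2) by (simp add: kernel_op_def)
  qed

  have Pp: "P \<in> \<pi> \<rightarrow>\<^sub>M prob_algebra \<pi>"
    using P by (simp add: measurable_cong_sets[OF sp refl] prob_algebra_def subprob_algebra_cong[OF sp])
  have AEP: "AE x in \<pi>. integrable (P x) ?\<phi>"
    by (rule AE_integrable_kernel[OF Pp not_empty]) (simp add: inv i\<phi>)
  have kP [measurable]: "kernel_op P ?\<phi> \<in> borel_measurable \<pi>"
    using borel_measurable_integrable[OF integrable_kernel_integral[OF Pp not_empty, unfolded inv, OF i\<phi>(1)]]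
    by (simp add: kernel_op_def[abs_def] comp_def)
  \<comment> \<open>Invariance speaks of \<pi>, while the weight here is \<open>v t\<close>; the
    product with the kernel integral of \<open>ln\<close> is controlled by Young's inequality. The
    summand \<open>1\<close> in \<open>Phi'\<close> gives the extra \<open>v t x\<close>.\<close>
  have ivP: "integrable \<pi> (\<lambda>x. v t x * kernel_op P ?\<phi> x)"
  proof -
    have "integrable \<pi> (\<lambda>x. v t x + v t x * (\<integral>y. ln (v t y) \<partial>P x))"
      using iv integrable_mult_kernel_ln[OF Pp not_empty inv iv iPhiv iln d v_ge] by simp
    moreover have "AE x in \<pi>. v t x * kernel_op P ?\<phi> x = v t x + v t x * (\<integral>y. ln (v t y) \<partial>P x)"
      using AE_integrable_kernel[OF Pp not_empty, unfolded inv, OF iln] AE_space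
    proof eventually_elim
      case (elim x)
      interpret Px: prob_space "P x"
        using measurable_space[OF Pp elim(2)] by (simp add: space_prob_algebra)
      show ?case using elim(1)
        by (simp add: kernel_op_def Phi'_def Px.prob_space distrib_left)
    qed
    moreover have "(\<lambda>x. \<integral>y. ln (v t y) \<partial>P x) \<in> borel_measurable \<pi>"
      using integrable_kernel_integral[OF Pp not_empty, unfolded inv, OF iln] by auto
    ultimately show ?thesis by (subst integrable_cong_AE) auto
  qed
  show ?ae using AEK AEP by eventually_elim simp
  show ?int1 using ivK ivP by (simp add: right_diff_distrib)
  show ?int2 using ivP i\<phi>(2) by (simp add: right_diff_distrib)

  \<comment> \<open>Return from the series versions to \<open>v t\<close>, apply duality for
    \<open>K\<close>, then add and subtract the term with \<open>P\<close>.\<close>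
  have "(\<integral>x. Phi' (V t x) * (W t x - V t x) \<partial>\<pi>) = (\<integral>x. W t x * ?\<phi> x - v t x * ?\<phi> x \<partial>\<pi>)"
    using v_V[OF t] by (intro integral_cong_AE) (auto simp: algebra_simps elim: eventually_mono)
  also have "\<dots> = (\<integral>x. v t x * kernel_op K ?\<phi> x \<partial>\<pi>) - (\<integral>x. v t x * ?\<phi> x \<partial>\<pi>)"
    using iW\<phi> i\<phi>(2) intK by simp
  also have "\<dots> = (\<integral>x. v t x * (kernel_op K ?\<phi> x - kernel_op P ?\<phi> x) \<partial>\<pi>) - dirichlet_form \<pi> P ?\<phi> (v t)"
    using ivK ivP i\<phi>(2) by (simp add: dirichlet_form_def right_diff_distrib)
  finally have "((\<lambda>s. \<integral>x. Phi (V s x) \<partial>\<pi>) has_real_derivative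
      (\<integral>x. v t x * (kernel_op K ?\<phi> x - kernel_op P ?\<phi> x) \<partial>\<pi>) - dirichlet_form \<pi> P ?\<phi> (v t)) (at t)"
    using D.has_real_derivative_entropy[OF t] by (simp add: V_def W_def)
  then show ?deriv
    \<comment> \<open>The integral formula for the divergence is known for \<open>s > 0\<close>, an
      open set around \<open>t\<close>.\<close>
    by (rule has_field_derivative_transform_within_open[where S="{0<..}"]) (use t KL in auto)
qed

text \<open>Finiteness and integrability are part of the conclusion because
  \<open>real_of_ereal\<close> sends infinity to \<open>0\<close> and a Bochner integral that
  diverges is \<open>0\<close>; with them the derivative formula has its intended meaning.\<close>

theorem theorem6:
  fixes n :: nat
    and Z :: "'z measure"
    and M :: "'w measure"
    and X :: "(nat \<Rightarrow> 'z) \<Rightarrow> nat \<Rightarrow> 'w \<Rightarrow> real ^ 'd"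
    and N :: "real \<Rightarrow> 'w \<Rightarrow> nat"
    and P\<^sub>S :: "(nat \<Rightarrow> 'z) \<Rightarrow> real ^ 'd \<Rightarrow> (real ^ 'd) measure"
    and P :: "real ^ 'd \<Rightarrow> (real ^ 'd) measure"
    and \<mu>\<^sub>0 \<pi> :: "(real ^ 'd) measure"
  defines "Zn \<equiv> (\<Pi>\<^sub>M i\<in>{..<n}. Z)"
  defines "\<rho> \<equiv> (\<lambda>S t. distr M borel (\<lambda>\<omega>. X S (N t \<omega>) \<omega>))"
  defines "v \<equiv> (\<lambda>S t. dens \<pi> (\<rho> S t))"
  assumes "n \<ge> 1"
    and "prob_space M"
    and mu0: "\<mu>\<^sub>0 \<in> space (prob_algebra borel)"
    and kernels: "\<And>S. S \<in> space Zn \<Longrightarrow> markov_kernel (P\<^sub>S S)"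
    and chains: "\<And>S. S \<in> space Zn \<Longrightarrow> markov_chain M (X S) (P\<^sub>S S) \<mu>\<^sub>0"
    and poisson: "poisson_process M 1 N"
    and indep: "prob_space.indep_set M
      (gen_events M (count_space UNIV) {0..} N)
      (gen_events M borel (space Zn \<times> UNIV) (\<lambda>(S, k). X S k))"
    and prior: "markov_kernel P" "\<pi> \<in> space (prob_algebra borel)" "\<pi> \<bind> P = \<pi>"
    and mu0_ac: "absolutely_continuous \<pi> \<mu>\<^sub>0"
    and KL0: "KL \<mu>\<^sub>0 \<pi> < \<infinity>"
    and v0: "\<exists>c>0. AE x in \<pi>. c \<le> dens \<pi> \<mu>\<^sub>0 x"
    and KL_meas: "\<And>t. t \<ge> 0 \<Longrightarrow> (\<lambda>S. KL (\<rho> S t) \<pi>) \<in> borel_measurable Zn"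
    and H1: "\<And>S \<mu>. S \<in> space Zn \<Longrightarrow> \<mu> \<in> space (prob_algebra borel) \<Longrightarrow>
      absolutely_continuous \<pi> \<mu> \<Longrightarrow> absolutely_continuous \<pi> (\<mu> \<bind> P\<^sub>S S)"
    and H2: "\<And>S t. S \<in> space Zn \<Longrightarrow> t \<ge> 0 \<Longrightarrow>
      integrable \<pi> (\<lambda>x. Phi (dual_op \<pi> (P\<^sub>S S) (v S t) x))"
  shows "\<forall>S\<in>space Zn. \<forall>t>0.
    KL (\<rho> S t) \<pi> < \<infinity> \<and>
    (AE x in \<pi>. integrable (P\<^sub>S S x) (Phi' \<circ> v S t) \<and> integrable (P x) (Phi' \<circ> v S t)) \<and>
    integrable \<pi>
      (\<lambda>x. v S t x * (kernel_op (P\<^sub>S S) (Phi' \<circ> v S t) x - kernel_op P (Phi' \<circ> v S t) x)) \<and>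
    integrable \<pi> (\<lambda>x. v S t x * (kernel_op P (Phi' \<circ> v S t) x - (Phi' \<circ> v S t) x)) \<and>
    ((\<lambda>s. real_of_ereal (KL (\<rho> S s) \<pi>)) has_real_derivative
      (\<integral>x. v S t x * (kernel_op (P\<^sub>S S) (Phi' \<circ> v S t) x - kernel_op P (Phi' \<circ> v S t) x) \<partial>\<pi>)
      - dirichlet_form \<pi> P (Phi' \<circ> v S t) (v S t)) (at t)"
proof (intro ballI allI impI)
  fix S and t :: real assume S: "S \<in> space Zn" and t: "0 < t"
  define \<mu> where "\<mu> k = distr M borel (X S k)" for k
  have X: "X S k \<in> M \<rightarrow>\<^sub>M borel" for k
    using chains[OF S] by (simp add: markov_chain_def)
  have mu: "\<mu> k \<in> space (prob_algebra borel)" for k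
    using prob_space.prob_space_distr[OF \<open>prob_space M\<close> X] by (simp add: \<mu>_def space_prob_algebra)
  have \<mu>_0: "\<mu> 0 = \<mu>\<^sub>0"
    using chains[OF S] by (simp add: \<mu>_def markov_chain_def)
  have \<mu>_Suc: "\<mu> (Suc k) = \<mu> k \<bind> P\<^sub>S S" for k
    unfolding \<mu>_def by (rule markov_chain_law_Suc[OF \<open>prob_space M\<close> chains[OF S] kernels[OF S]])
  \<comment> \<open>By (H.1) absolute continuity passes from one step of the chain to the next,
    starting from the initial law.\<close>
  have \<mu>_ac: "absolutely_continuous \<pi> (\<mu> k)" for k
  proof (induction k)
    case (Suc k)
    then show ?case unfolding \<mu>_Suc by (rule H1[OF S mu])
  qed (simp add: \<mu>_0 mu0_ac)
  have \<rho>_mix: "emeasure (\<rho> S t) A = (\<Sum>k. ennreal (pmf (poisson_pmf t) k) * emeasure (\<mu> k) A)"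
    if "0 < t" "A \<in> sets borel" for t A
    using emeasure_distr_poisson_time[where X=X, OF \<open>prob_space M\<close> X S poisson indep that]
    unfolding \<rho>_def \<mu>_def mult_1 .
  have \<rho>_sets: "sets (\<rho> S t) = sets borel" for t
    by (simp add: \<rho>_def)
  show "KL (\<rho> S t) \<pi> < \<infinity> \<and>
      (AE x in \<pi>. integrable (P\<^sub>S S x) (Phi' \<circ> v S t) \<and> integrable (P x) (Phi' \<circ> v S t)) \<and>
      integrable \<pi>
        (\<lambda>x. v S t x * (kernel_op (P\<^sub>S S) (Phi' \<circ> v S t) x - kernel_op P (Phi' \<circ> v S t) x)) \<and>
      integrable \<pi> (\<lambda>x. v S t x * (kernel_op P (Phi' \<circ> v S t) x - (Phi' \<circ> v S t) x)) \<and>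
      ((\<lambda>s. real_of_ereal (KL (\<rho> S s) \<pi>)) has_real_derivative
        (\<integral>x. v S t x * (kernel_op (P\<^sub>S S) (Phi' \<circ> v S t) x - kernel_op P (Phi' \<circ> v S t) x) \<partial>\<pi>)
        - dirichlet_form \<pi> P (Phi' \<circ> v S t) (v S t)) (at t)"
    unfolding v_def
    by (intro conjI KL_poisson_mix_has_derivative[OF prior(2) kernels[OF S] prior(1,3) mu \<mu>_ac \<mu>_Suc
          \<rho>_sets \<rho>_mix KL0[folded \<mu>_0] v0[folded \<mu>_0] H2[OF S, unfolded v_def, OF less_imp_le] t])
qed

end
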